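(* Let $L_{\mathrm{prime}}\subseteq\{0,1\}^*$ be the language of all words obtained by writing a prime number in binary and reading the expansion from right to left (least significant digit first), and let $L_{\mathrm{sqf}}\subseteq\{0,1\}^*$ be the language obtained in the same way from the squarefree positive integers. For a language $L$, let $f^{\mathrm{alt}}_L(n)$ and $f^{\mathrm{det}}_L(n)$ denote its alternating and deterministic state complexity, respectively. Then: (1) There exists a constant $c>0$ such that $f^{\mathrm{alt}}_{L_{\mathrm{prime}}}(n)\geq c\,\frac{2^{n/2}\log n}{n}$ for all integers $n\geq 1$. (2) Both $f^{\mathrm{det}}_{L_{\mathrm{sqf}}}(n)=2^{n+\mathcal{O}(1)}$ and $f^{\mathrm{alt}}_{L_{\mathrm{sqf}}}(n)=2^{n+\mathcal{O}(1)}$; that is, there exists a constant $C$ such that $2^{n-C}\leq f^{\mathrm{det}}_{L_{\mathrm{sqf}}}(n)\leq 2^{n+C}$ and $2^{n-C}\leq f^{\mathrm{alt}}_{L_{\mathrm{sqf}}}(n)\leq 2^{n+C}$ for all integers $n\geq 1$.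
   Context: Integers and words. A positive integer $m$ with binary expansion $m=\sum_{i=1}^{k}a_i2^{i-1}$, $a_i\in\{0,1\}$, $a_k=1$, is identified with the word $a_1a_2\dots a_k\in\{0,1\}^*$; automata read $a_1$ first. A positive integer is squarefree if it is not divisible by the square of any prime. Deterministic automata. A deterministic automaton over an alphabet $\mathcal{A}$ consists of a (possibly infinite) set of states $S$, a starting state $s_0\in S$, a set of accepting states $A\subseteq S$, and a transition function $\delta:S\times\mathcal{A}\to S$. A word $w=a_1a_2\dots a_k\in\mathcal{A}^*$ reaches the state $s_w$ obtained by starting in $s_0$ and applying successively the transitions for $a_1,a_2,\dots,a_k$; the word is accepted if $s_w\in A$. Alternating automata. An alternating automaton over $\mathcal{A}$ likewise consists of a (possibly infinite) set of states $S$, a starting state $s_0\in S$, and a set of accepting states $A\subseteq S$, but its transition function $\delta$ assigns to each pair of a letter $a\in\mathcal{A}$ and a state $s\in S$ a finite positive boolean combination of atomic formulae of the form "$\delta=s'$" with $s'\in S$ (positive means: built from atomic formulae using only $\wedge$ and $\vee$, without $\neg$). A word $w$ is accepted if Alice has a winning strategy in the following game between Alice and Eve. The game begins in $s_0$, and the letters of $w$ are read one after the other. When a letter $a$ is read and the game is in state $s$, the formula $\phi=\delta(a,s)$ is considered. If $\phi$ is atomic, $\phi=(\delta=s')$, the game moves to state $s'$ and the next letter is read. If $\phi=\psi\wedge\theta$, Eve replaces $\phi$ by one of $\psi,\theta$; if $\phi=\psi\vee\theta$, Alice replaces $\phi$ by one of $\psi,\theta$; this is repeated until the formula is atomic. Alice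 wins if after reading all of $w$ the game is in an accepting state; otherwise Eve wins. A state is reachable by a word $w$ if some play of the game on $w$ (some sequence of choices of both players) ends in this state. An automaton recognizes a language $L\subseteq\mathcal{A}^*$ if it accepts exactly the words in $L$. State complexity. The deterministic (respectively alternating) state complexity of a language $L$ is the function that associates to each integer $n$ the minimum, over all deterministic (respectively alternating) automata recognizing $L$, of the number of states of the automaton that are reachable by words of length $\leq n$. *)

theory Defs
  imports Complex_Main "HOL-Library.Countable_Set" "HOL-Computational_Algebra.Squarefree"
begin

section \<open>Binary words\<close>

text \<open>Digits are booleans, with \<open>True\<close> for the digit 1; the head of the list is the least
  significant digit, and the most significant digit must be 1.\<close>

definition lsd_expansion :: "bool list \<Rightarrow> nat \<Rightarrow> bool" where
  "lsd_expansion w m \<longleftrightarrow>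
     w \<noteq> [] \<and> last w \<and> m = (\<Sum>i<length w. of_bool (w ! i) * 2 ^ i)"

definition L_prime :: "bool list set" where
  "L_prime = {w. \<exists>m::nat. prime m \<and> lsd_expansion w m}"

definition L_sqf :: "bool list set" where
  "L_sqf = {w. \<exists>m::nat. squarefree m \<and> lsd_expansion w m}"


section \<open>Deterministic automata\<close>

record ('a, 's) det_automaton =
  det_states :: "'s set"
  det_start :: 's
  det_accepting :: "'s set"
  det_trans :: "'s \<Rightarrow> 'a \<Rightarrow> 's"

definition det_wf :: "('a, 's) det_automaton \<Rightarrow> bool" where
  "det_wf M \<longleftrightarrow>
     det_start M \<in> det_states M \<and> det_accepting M \<subseteq> det_states M \<and>
     (\<forall>s\<in>det_states M. \<forall>a. det_trans M s a \<in> det_states M)"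

definition det_reached :: "('a, 's) det_automaton \<Rightarrow> 'a list \<Rightarrow> 's" where
  "det_reached M w = foldl (det_trans M) (det_start M) w"

definition det_recognizes :: "('a, 's) det_automaton \<Rightarrow> 'a list set \<Rightarrow> bool" where
  "det_recognizes M L \<longleftrightarrow> {w. det_reached M w \<in> det_accepting M} = L"

definition det_reachable_upto :: "('a, 's) det_automaton \<Rightarrow> nat \<Rightarrow> 's set" where
  "det_reachable_upto M n = {det_reached M w | w. length w \<le> n}"


section \<open>Alternating automata\<close>

datatype 's pos_formula =
    Atom 's
  | Conj "'s pos_formula" "'s pos_formula"
  | Disj "'s pos_formula" "'s pos_formula"

record ('a, 's) alt_automaton =
  alt_states :: "'s set"
  alt_start :: 's
  alt_accepting :: "'s set"
  alt_trans :: "'a \<Rightarrow> 's \<Rightarrow> 's pos_formula"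

definition alt_wf :: "('a, 's) alt_automaton \<Rightarrow> bool" where
  "alt_wf M \<longleftrightarrow>
     alt_start M \<in> alt_states M \<and> alt_accepting M \<subseteq> alt_states M \<and>
     (\<forall>s\<in>alt_states M. \<forall>a. set_pos_formula (alt_trans M a s) \<subseteq> alt_states M)"

text \<open>A history is the list of all choices made so far by both players, in chronological order
  (\<open>True\<close> for the left subformula). For a given word it determines the current position of the
  game, so a strategy (of either player) is a function from histories to choices. Alice's
  strategy is \<open>\<sigma>\<close> and Eve's is \<open>\<tau>\<close>.\<close>

type_synonym strategy = "bool list \<Rightarrow> bool"

fun resolve :: "strategy \<Rightarrow> strategy \<Rightarrow> bool list \<Rightarrow> 's pos_formula \<Rightarrow> bool list \<times> 's" where
  "resolve \<sigma> \<tau> h (Atom s) = (h, s)"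
| "resolve \<sigma> \<tau> h (Conj \<psi> \<theta>) = resolve \<sigma> \<tau> (h @ [\<tau> h]) (if \<tau> h then \<psi> else \<theta>)"
| "resolve \<sigma> \<tau> h (Disj \<psi> \<theta>) = resolve \<sigma> \<tau> (h @ [\<sigma> h]) (if \<sigma> h then \<psi> else \<theta>)"

fun play_from ::
  "('a, 's) alt_automaton \<Rightarrow> strategy \<Rightarrow> strategy \<Rightarrow> bool list \<Rightarrow> 's \<Rightarrow> 'a list \<Rightarrow> 's" where
  "play_from M \<sigma> \<tau> h s [] = s"
| "play_from M \<sigma> \<tau> h s (a # w) =
     (let (h', s') = resolve \<sigma> \<tau> h (alt_trans M a s) in play_from M \<sigma> \<tau> h' s' w)"

definition play_result ::
  "('a, 's) alt_automaton \<Rightarrow> strategy \<Rightarrow> strategy \<Rightarrow> 'a list \<Rightarrow> 's" where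
  "play_result M \<sigma> \<tau> w = play_from M \<sigma> \<tau> [] (alt_start M) w"

definition alt_accepts :: "('a, 's) alt_automaton \<Rightarrow> 'a list \<Rightarrow> bool" where
  "alt_accepts M w \<longleftrightarrow> (\<exists>\<sigma>. \<forall>\<tau>. play_result M \<sigma> \<tau> w \<in> alt_accepting M)"

definition alt_recognizes :: "('a, 's) alt_automaton \<Rightarrow> 'a list set \<Rightarrow> bool" where
  "alt_recognizes M L \<longleftrightarrow> {w. alt_accepts M w} = L"

definition alt_reachable_upto :: "('a, 's) alt_automaton \<Rightarrow> nat \<Rightarrow> 's set" where
  "alt_reachable_upto M n = {play_result M \<sigma> \<tau> w | \<sigma> \<tau> w. length w \<le> n}"


section \<open>State complexity\<close>

text \<open>HOL cannot quantify over all state types inside a definition, so states are drawn from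
  \<^typ>\<open>nat\<close>. This loses nothing: the theorems \<open>is_det_state_complexity\<close> and
  \<open>is_alt_state_complexity\<close> at the end of this theory show that the value is attained and is a
  lower bound for automata over every state type. The finiteness lemmas there show
  that \<^const>\<open>card\<close> is only applied to finite sets.\<close>

definition det_state_complexity :: "'a::finite list set \<Rightarrow> nat \<Rightarrow> nat" where
  "det_state_complexity L n =
     Inf {card (det_reachable_upto M n) | M :: ('a, nat) det_automaton.
            det_wf M \<and> det_recognizes M L}"

definition alt_state_complexity :: "'a::finite list set \<Rightarrow> nat \<Rightarrow> nat" where
  "alt_state_complexity L n =
     Inf {card (alt_reachable_upto M n) | M :: ('a, nat) alt_automaton.
            alt_wf M \<and> alt_recognizes M L}"


subsection \<open>Finiteness of the sets of reachable states\<close>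

lemma finite_words_upto: "finite {w :: 'a::finite list. length w \<le> n}"
  using finite_lists_length_le[of "UNIV :: 'a set" n] by simp

lemma finite_det_reachable_upto:
  fixes M :: "('a::finite, 's) det_automaton"
  shows "finite (det_reachable_upto M n)"
proof -
  have "det_reachable_upto M n = det_reached M ` {w. length w \<le> n}"
    by (auto simp: det_reachable_upto_def)
  then show ?thesis by (simp add: finite_words_upto)
qed

lemma resolve_in_atoms: "snd (resolve \<sigma> \<tau> h \<phi>) \<in> set_pos_formula \<phi>"
  by (induction \<phi> arbitrary: h) auto

lemma finite_set_pos_formula: "finite (set_pos_formula \<phi>)"
  by (induction \<phi>) auto

lemma finite_play_from: "finite {play_from M \<sigma> \<tau> h s w | \<sigma> \<tau> h. True}"
proof (induction w arbitrary: s)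
  case Nil
  then show ?case by simp
next
  case (Cons a w)
  have "{play_from M \<sigma> \<tau> h s (a # w) | \<sigma> \<tau> h. True}
      \<subseteq> (\<Union>s'\<in>set_pos_formula (alt_trans M a s). {play_from M \<sigma> \<tau> h s' w | \<sigma> \<tau> h. True})"
    (is "_ \<subseteq> ?R")
  proof clarify
    fix \<sigma> \<tau> h
    obtain h' s' where r: "resolve \<sigma> \<tau> h (alt_trans M a s) = (h', s')" by fastforce
    have "s' \<in> set_pos_formula (alt_trans M a s)"
      using resolve_in_atoms[of \<sigma> \<tau> h "alt_trans M a s"] r by simp
    then show "play_from M \<sigma> \<tau> h s (a # w) \<in> ?R"
      using r by auto
  qed
  moreover have "finite ?R" using Cons.IH finite_set_pos_formula by blast
  ultimately show ?case using finite_subset by blast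
qed

lemma finite_alt_reachable_upto:
  fixes M :: "('a::finite, 's) alt_automaton"
  shows "finite (alt_reachable_upto M n)"
proof -
  have "alt_reachable_upto M n
      \<subseteq> (\<Union>w\<in>{w. length w \<le> n}. {play_from M \<sigma> \<tau> h (alt_start M) w | \<sigma> \<tau> h. True})"
    (is "_ \<subseteq> ?R") by (auto simp: alt_reachable_upto_def play_result_def)
  moreover have "finite ?R" by (intro finite_UN_I finite_words_upto finite_play_from)
  ultimately show ?thesis using finite_subset by blast
qed


subsection \<open>Independence of the state type\<close>

lemma det_nat_copy:
  fixes M :: "('a::finite, 's) det_automaton"
  assumes rec: "det_recognizes M L"
  shows "\<exists>N :: ('a, nat) det_automaton. det_wf N \<and> det_recognizes N L \<and>
           (\<forall>n. card (det_reachable_upto N n) = card (det_reachable_upto M n))"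
proof -
  define R where "R = range (det_reached M)"
  have R0: "det_start M \<in> R"
    unfolding R_def by (rule range_eqI[of _ _ "[]"]) (simp add: det_reached_def)
  have Rstep: "det_trans M s a \<in> R" if sR: "s \<in> R" for s a
  proof -
    obtain w where "s = det_reached M w" using sR by (auto simp: R_def)
    then have "det_trans M s a = det_reached M (w @ [a])" by (simp add: det_reached_def)
    then show ?thesis by (simp add: R_def)
  qed
  have "countable R" by (simp add: R_def)
  then obtain f :: "'s \<Rightarrow> nat" where f: "inj_on f R" by (auto simp: countable_def)
  define N where "N = \<lparr>det_states = f ` R, det_start = f (det_start M),
     det_accepting = f ` (det_accepting M \<inter> R),
     det_trans = (\<lambda>q a. f (det_trans M (inv_into R f q) a))\<rparr>"
  have reached: "det_reached N w = f (det_reached M w)" for w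
  proof (induction w rule: rev_induct)
    case Nil
    then show ?case by (simp add: N_def det_reached_def)
  next
    case (snoc a w)
    have "det_reached M w \<in> R" by (simp add: R_def)
    with snoc f show ?case by (simp add: N_def det_reached_def)
  qed
  have "det_wf N" using R0 Rstep f by (auto simp: det_wf_def N_def)
  moreover have "det_reached N w \<in> det_accepting N \<longleftrightarrow> det_reached M w \<in> det_accepting M" for w
  proof -
    have "det_reached M w \<in> R" by (simp add: R_def)
    then show ?thesis using f by (auto simp: reached) (auto simp: N_def dest: inj_onD)
  qed
  then have "det_recognizes N L" using rec by (simp add: det_recognizes_def)
  moreover have "card (det_reachable_upto N n) = card (det_reachable_upto M n)" for n
  proof -
    have "det_reachable_upto N n = f ` det_reachable_upto M n"
      by (auto simp: det_reachable_upto_def reached)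
    moreover have "det_reachable_upto M n \<subseteq> R" by (auto simp: det_reachable_upto_def R_def)
    ultimately show ?thesis using f by (metis card_image inj_on_subset)
  qed
  ultimately show ?thesis by (intro exI[of _ N]) simp
qed

lemma det_ex:
  fixes L :: "'a::finite list set"
  shows "\<exists>M :: ('a, nat) det_automaton. det_wf M \<and> det_recognizes M L"
proof -
  define M where "M = \<lparr>det_states = UNIV, det_start = [], det_accepting = L,
     det_trans = (\<lambda>w a. w @ [a])\<rparr>"
  have "det_reached M w = w" for w
    by (induction w rule: rev_induct) (simp_all add: M_def det_reached_def)
  then have "det_recognizes M L" by (simp add: det_recognizes_def M_def)
  then show ?thesis using det_nat_copy by blast
qed

lemma alt_nat_copy:
  fixes M :: "('a::finite, 's) alt_automaton"
  assumes rec: "alt_recognizes M L"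
  shows "\<exists>N :: ('a, nat) alt_automaton. alt_wf N \<and> alt_recognizes N L \<and>
           (\<forall>n. card (alt_reachable_upto N n) = card (alt_reachable_upto M n))"
proof -
  define step where
    "step X = (\<Union>s\<in>X. \<Union>a. set_pos_formula (alt_trans M a s))" for X
  define R where "R = (\<Union>k. (step ^^ k) {alt_start M})"
  have R0: "alt_start M \<in> R"
    unfolding R_def by (rule UN_I[of 0]) simp_all
  have Rstep: "set_pos_formula (alt_trans M a s) \<subseteq> R" if sR: "s \<in> R" for s a
  proof -
    obtain k where "s \<in> (step ^^ k) {alt_start M}" using sR by (auto simp: R_def)
    then have "set_pos_formula (alt_trans M a s) \<subseteq> (step ^^ Suc k) {alt_start M}"
      by (auto simp: step_def)
    then show ?thesis unfolding R_def by blast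
  qed
  have "countable ((step ^^ k) {alt_start M})" for k
    by (induction k) (simp_all add: step_def finite_set_pos_formula countable_finite)
  then have "countable R" by (simp add: R_def)
  then obtain f :: "'s \<Rightarrow> nat" where f: "inj_on f R" by (auto simp: countable_def)
  define N where "N = \<lparr>alt_states = f ` R, alt_start = f (alt_start M),
     alt_accepting = f ` (alt_accepting M \<inter> R),
     alt_trans = (\<lambda>a q. map_pos_formula f (alt_trans M a (inv_into R f q)))\<rparr>"
  have res: "resolve \<sigma> \<tau> h (map_pos_formula f \<phi>) = map_prod id f (resolve \<sigma> \<tau> h \<phi>)" for \<sigma> \<tau> h \<phi>
    by (induction \<phi> arbitrary: h) auto
  have play: "play_from N \<sigma> \<tau> h (f s) w = f (play_from M \<sigma> \<tau> h s w) \<and> play_from M \<sigma> \<tau> h s w \<in> R"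
    if "s \<in> R" for \<sigma> \<tau> h s w
    using that
  proof (induction w arbitrary: h s)
    case Nil
    then show ?case by simp
  next
    case (Cons a w)
    obtain h' s' where r: "resolve \<sigma> \<tau> h (alt_trans M a s) = (h', s')" by fastforce
    have "s' \<in> R"
      using resolve_in_atoms[of \<sigma> \<tau> h "alt_trans M a s"] r Rstep[OF Cons.prems] by auto
    moreover have "alt_trans N a (f s) = map_pos_formula f (alt_trans M a s)"
      using Cons.prems f by (simp add: N_def)
    ultimately show ?case using r Cons.IH by (simp add: res)
  qed
  have result: "play_result N \<sigma> \<tau> w = f (play_result M \<sigma> \<tau> w)"
    and resR: "play_result M \<sigma> \<tau> w \<in> R" for \<sigma> \<tau> w
    using play[OF R0] by (simp_all add: play_result_def N_def)
  have "alt_wf N" using R0 Rstep f by (auto simp: alt_wf_def N_def pos_formula.set_map)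
  moreover have "play_result N \<sigma> \<tau> w \<in> alt_accepting N
      \<longleftrightarrow> play_result M \<sigma> \<tau> w \<in> alt_accepting M" for \<sigma> \<tau> w
    using f resR[of \<sigma> \<tau> w] by (auto simp: result) (auto simp: N_def dest: inj_onD)
  then have "alt_recognizes N L" using rec by (simp add: alt_recognizes_def alt_accepts_def)
  moreover have "card (alt_reachable_upto N n) = card (alt_reachable_upto M n)" for n
  proof -
    have "alt_reachable_upto N n = f ` alt_reachable_upto M n"
      by (auto simp: alt_reachable_upto_def result)
    moreover have "alt_reachable_upto M n \<subseteq> R" using resR by (auto simp: alt_reachable_upto_def)
    ultimately show ?thesis using f by (metis card_image inj_on_subset)
  qed
  ultimately show ?thesis by (intro exI[of _ N]) simp
qed

lemma alt_ex:
  fixes L :: "'a::finite list set"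
  shows "\<exists>M :: ('a, nat) alt_automaton. alt_wf M \<and> alt_recognizes M L"
proof -
  define M where "M = \<lparr>alt_states = UNIV, alt_start = [], alt_accepting = L,
     alt_trans = (\<lambda>a w. Atom (w @ [a]))\<rparr>"
  have "play_from M \<sigma> \<tau> h u w = u @ w" for \<sigma> \<tau> h u w
    by (induction w arbitrary: u) (simp_all add: M_def)
  then have "alt_recognizes M L"
    by (simp add: alt_recognizes_def alt_accepts_def play_result_def) (simp add: M_def)
  then show ?thesis using alt_nat_copy by blast
qed

theorem is_det_state_complexity:
  fixes L :: "'a::finite list set" and n :: nat
  shows "\<exists>M :: ('a, nat) det_automaton. det_wf M \<and> det_recognizes M L \<and>
           card (det_reachable_upto M n) = det_state_complexity L n"
    and "\<And>M :: ('a, 's) det_automaton. det_wf M \<Longrightarrow> det_recognizes M L \<Longrightarrow>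
           det_state_complexity L n \<le> card (det_reachable_upto M n)"
proof -
  let ?S = "{card (det_reachable_upto M n) | M :: ('a, nat) det_automaton.
               det_wf M \<and> det_recognizes M L}"
  have "?S \<noteq> {}" using det_ex[of L] by blast
  then have "det_state_complexity L n \<in> ?S"
    unfolding det_state_complexity_def by (rule Inf_nat_def1)
  then show "\<exists>M :: ('a, nat) det_automaton. det_wf M \<and> det_recognizes M L \<and>
           card (det_reachable_upto M n) = det_state_complexity L n" by auto
  fix M :: "('a, 's) det_automaton"
  assume "det_recognizes M L"
  then obtain N :: "('a, nat) det_automaton" where "det_wf N" "det_recognizes N L"
    and card: "card (det_reachable_upto N n) = card (det_reachable_upto M n)"
    using det_nat_copy by blast
  then have "card (det_reachable_upto N n) \<in> ?S" by blast
  then have "card (det_reachable_upto M n) \<in> ?S" unfolding card .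
  then show "det_state_complexity L n \<le> card (det_reachable_upto M n)"
    unfolding det_state_complexity_def by (rule cInf_lower) simp
qed

theorem is_alt_state_complexity:
  fixes L :: "'a::finite list set" and n :: nat
  shows "\<exists>M :: ('a, nat) alt_automaton. alt_wf M \<and> alt_recognizes M L \<and>
           card (alt_reachable_upto M n) = alt_state_complexity L n"
    and "\<And>M :: ('a, 's) alt_automaton. alt_wf M \<Longrightarrow> alt_recognizes M L \<Longrightarrow>
           alt_state_complexity L n \<le> card (alt_reachable_upto M n)"
proof -
  let ?S = "{card (alt_reachable_upto M n) | M :: ('a, nat) alt_automaton.
               alt_wf M \<and> alt_recognizes M L}"
  have "?S \<noteq> {}" using alt_ex[of L] by blast
  then have "alt_state_complexity L n \<in> ?S"
    unfolding alt_state_complexity_def by (rule Inf_nat_def1)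
  then show "\<exists>M :: ('a, nat) alt_automaton. alt_wf M \<and> alt_recognizes M L \<and>
           card (alt_reachable_upto M n) = alt_state_complexity L n" by auto
  fix M :: "('a, 's) alt_automaton"
  assume "alt_recognizes M L"
  then obtain N :: "('a, nat) alt_automaton" where "alt_wf N" "alt_recognizes N L"
    and card: "card (alt_reachable_upto N n) = card (alt_reachable_upto M n)"
    using alt_nat_copy by blast
  then have "card (alt_reachable_upto N n) \<in> ?S" by blast
  then have "card (alt_reachable_upto M n) \<in> ?S" unfolding card .
  then show "alt_state_complexity L n \<le> card (alt_reachable_upto M n)"
    unfolding alt_state_complexity_def by (rule cInf_lower) simp
qed

end

theory Submission imports Defs "HOL-Number_Theory.Cong" begin

text \<open>
  Both lower bounds count columns. Fix \<open>n\<close> and a set \<open>Q\<close> of integers; the column of \<open>b \<ge> 1\<close> is the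
  set of all \<open>a < 2 ^ n\<close> with \<open>a + 2 ^ n * b \<in> Q\<close>. Reading the \<open>n\<close> low digits \<open>u\<close> of a number turns the
  start state of an alternating automaton into a positive boolean combination of states
  reachable by words of length at most \<open>n\<close>. Hence acceptance of \<open>u @ v\<close> depends on \<open>v\<close> only
  through the set of reachable states from which \<open>v\<close> is accepted, and with \<open>f\<close> reachable states
  there are at most \<open>2 ^ f\<close> columns (\<open>card_columns_le\<close>).

  For squarefree numbers, every subset \<open>T\<close> of the odd squarefree \<open>a < 2 ^ n\<close> is the trace of a
  column (\<open>squarefree_patterns\<close>). The Chinese remainder theorem provides \<open>b\<close> that is divisible by
  \<open>p\<^sup>2\<close> for every odd prime \<open>p \<le> 2 * 2 ^ n\<close>, so that no such \<open>p\<^sup>2\<close> divides \<open>a + 2 ^ n * b\<close>,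
  and that makes \<open>a + 2 ^ n * b\<close> divisible by the square of a private large prime for each
  \<open>a\<close> outside \<open>T\<close>; a union bound over the other large primes leaves a suitable \<open>b\<close>. As at least a
  quarter of all \<open>a < 2 ^ n\<close> are odd and squarefree, \<open>f \<ge> 2 ^ (n - 2)\<close>. The upper bounds come from
  the automaton whose states are all words.

  Columns of the primes cannot be prescribed, but those with many elements are frequent as a whole
  and rare one by one. Let \<open>m\<close> be about \<open>2 ^ (n / 2) / n\<close> and let \<open>b\<close> range up to
  \<open>X = 2 ^ (6 * m * n)\<close>. By Chebyshev's lower bound for the number of primes, a proportion of at
  least \<open>1 / (2 * J)\<close> of the \<open>b\<close> have a column with at least \<open>k = 2 ^ n div (4 * J)\<close> elements, where
  \<open>J = n * (6 * m + 1)\<close>; here \<open>k\<close> is of order \<open>2 ^ (n / 2)\<close> (\<open>many_prime_rich_columns\<close>). On the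
  other hand, if \<open>a + 2 ^ n * b\<close> is prime for all \<open>a\<close> in a fixed set \<open>S\<close> of size \<open>k\<close>, then for each
  prime \<open>p\<close> between \<open>2 ^ (n / 2)\<close> and \<open>2 ^ n\<close> the number of \<open>a \<in> S\<close> with \<open>p dvd a + 2 ^ n * b\<close> is \<open>0\<close>
  instead of its mean \<open>k / p\<close>. The deviations \<open>g p b\<close> from the mean behave, for random \<open>b < X\<close>, like
  independent variables as long as only products of at most \<open>2 * m\<close> of them are averaged, and their
  variances are about \<open>k / p\<close>. Comparing the second moment of the \<open>m\<close>-th elementary symmetric
  polynomial in the \<open>g p b\<close> with its value at the exceptional \<open>b\<close> shows that these have density at
  most \<open>3 * (C * m / (k * \<sigma>)) ^ m\<close>, where \<open>\<sigma>\<close> is the sum of all \<open>1 / p\<close>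
  (\<open>second_moment_sieve\<close>, \<open>card_simultaneous_primes_le\<close>). The window of primes is chosen so
  wide that \<open>\<sigma>\<close> is bounded below, so this density is at most \<open>3 * (C' / n) ^ m\<close>. Dividing the two
  estimates gives at least \<open>(n / C') ^ m / (6 * J)\<close> columns, and the logarithm of this number is of
  order \<open>m * ln n\<close>.
\<close>

section \<open>Alternating automata as boolean combinations of residual languages\<close>

fun holds :: "('s \<Rightarrow> bool) \<Rightarrow> 's pos_formula \<Rightarrow> bool" where
  "holds P (Atom s) = P s"
| "holds P (Conj \<psi> \<theta>) = (holds P \<psi> \<and> holds P \<theta>)"
| "holds P (Disj \<psi> \<theta>) = (holds P \<psi> \<or> holds P \<theta>)"

lemma holds_cong: "(\<And>s. s \<in> set_pos_formula \<phi> \<Longrightarrow> P s = Q s) \<Longrightarrow> holds P \<phi> = holds Q \<phi>"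
  by (induction \<phi>) auto

fun accepts_from :: "('a, 's) alt_automaton \<Rightarrow> 'a list \<Rightarrow> 's \<Rightarrow> bool" where
  "accepts_from M [] s \<longleftrightarrow> s \<in> alt_accepting M"
| "accepts_from M (a # w) s \<longleftrightarrow> holds (accepts_from M w) (alt_trans M a s)"

text \<open>
  The game continued from a formula that is still being resolved. Plays are analysed through this
  function because induction over a transition formula passes through such intermediate positions.
\<close>

definition outcome ::
  "('a, 's) alt_automaton \<Rightarrow> strategy \<Rightarrow> strategy \<Rightarrow> bool list \<Rightarrow> 's pos_formula \<Rightarrow> 'a list \<Rightarrow> 's" where
  "outcome M \<sigma> \<tau> h \<phi> w =
     (let (h', s') = resolve \<sigma> \<tau> h \<phi> in play_from M \<sigma> \<tau> h' s' w)"

lemma outcome_simps [simp]: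
  "outcome M \<sigma> \<tau> h (Atom s) w = play_from M \<sigma> \<tau> h s w"
  "outcome M \<sigma> \<tau> h (Conj \<psi> \<theta>) w = outcome M \<sigma> \<tau> (h @ [\<tau> h]) (if \<tau> h then \<psi> else \<theta>) w"
  "outcome M \<sigma> \<tau> h (Disj \<psi> \<theta>) w = outcome M \<sigma> \<tau> (h @ [\<sigma> h]) (if \<sigma> h then \<psi> else \<theta>) w"
  by (simp_all add: outcome_def)

lemma play_from_Cons: "play_from M \<sigma> \<tau> h s (a # w) = outcome M \<sigma> \<tau> h (alt_trans M a s) w"
  by (simp add: outcome_def)

lemma outcome_cong_if_play_from_cong:
  assumes play: "\<And>s h. (\<And>e. \<sigma> (h @ e) = \<sigma>' (h @ e)) \<Longrightarrow> (\<And>e. \<tau> (h @ e) = \<tau>' (h @ e)) \<Longrightarrow>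
      play_from M \<sigma> \<tau> h s w = play_from M \<sigma>' \<tau>' h s w"
    and "\<And>e. \<sigma> (h @ e) = \<sigma>' (h @ e)" "\<And>e. \<tau> (h @ e) = \<tau>' (h @ e)"
  shows "outcome M \<sigma> \<tau> h \<phi> w = outcome M \<sigma>' \<tau>' h \<phi> w"
  using assms(2,3)
proof (induction \<phi> arbitrary: h)
  case (Atom s)
  then show ?case using play by simp
next
  case (Conj \<psi> \<theta>)
  have "\<tau> h = \<tau>' h" using Conj.prems(2)[of "[]"] by simp
  moreover have "outcome M \<sigma> \<tau> (h @ [c]) \<psi> w = outcome M \<sigma>' \<tau>' (h @ [c]) \<psi> w"
    "outcome M \<sigma> \<tau> (h @ [c]) \<theta> w = outcome M \<sigma>' \<tau>' (h @ [c]) \<theta> w" for c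
    using Conj.prems by (intro Conj.IH; simp)+
  ultimately show ?case by simp
next
  case (Disj \<psi> \<theta>)
  have "\<sigma> h = \<sigma>' h" using Disj.prems(1)[of "[]"] by simp
  moreover have "outcome M \<sigma> \<tau> (h @ [c]) \<psi> w = outcome M \<sigma>' \<tau>' (h @ [c]) \<psi> w"
    "outcome M \<sigma> \<tau> (h @ [c]) \<theta> w = outcome M \<sigma>' \<tau>' (h @ [c]) \<theta> w" for c
    using Disj.prems by (intro Disj.IH; simp)+
  ultimately show ?case by simp
qed

text \<open>
  Since a play never shortens its history, only the choices at histories extending the current one
  matter. This locality is what allows strategies for different branches to be glued together.
\<close>

lemma play_from_cong:
  assumes "\<And>e. \<sigma> (h @ e) = \<sigma>' (h @ e)" "\<And>e. \<tau> (h @ e) = \<tau>' (h @ e)"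
  shows "play_from M \<sigma> \<tau> h s w = play_from M \<sigma>' \<tau>' h s w"
  using assms
proof (induction w arbitrary: h s)
  case (Cons a w)
  show ?case unfolding play_from_Cons
    by (intro outcome_cong_if_play_from_cong Cons)
qed simp

lemma outcome_cong:
  assumes "\<And>e. \<sigma> (h @ e) = \<sigma>' (h @ e)" "\<And>e. \<tau> (h @ e) = \<tau>' (h @ e)"
  shows "outcome M \<sigma> \<tau> h \<phi> w = outcome M \<sigma>' \<tau>' h \<phi> w"
  using assms by (intro outcome_cong_if_play_from_cong play_from_cong)

text \<open>
  At a conjunction, Alice has one winning strategy for each choice of Eve. Eve's choice is recorded
  in the history at position \<open>length h\<close>, so the two strategies combine into one that reads this
  entry; at a disjunction a winning strategy is modified at the single history \<open>h\<close>.
\<close>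

lemma alice_wins_outcome:
  assumes play: "\<And>s h. accepts_from M w s \<Longrightarrow> \<exists>\<sigma>. \<forall>\<tau>. play_from M \<sigma> \<tau> h s w \<in> alt_accepting M"
    and "holds (accepts_from M w) \<phi>"
  shows "\<exists>\<sigma>. \<forall>\<tau>. outcome M \<sigma> \<tau> h \<phi> w \<in> alt_accepting M"
  using assms(2)
proof (induction \<phi> arbitrary: h)
  case (Atom s)
  then show ?case using play by simp
next
  case (Conj \<psi> \<theta>)
  obtain \<sigma>1 where 1: "\<And>\<tau>. outcome M \<sigma>1 \<tau> (h @ [True]) \<psi> w \<in> alt_accepting M"
    using Conj.IH(1) Conj.prems by (metis holds.simps(2))
  obtain \<sigma>2 where 2: "\<And>\<tau>. outcome M \<sigma>2 \<tau> (h @ [False]) \<theta> w \<in> alt_accepting M"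
    using Conj.IH(2) Conj.prems by (metis holds.simps(2))
  \<comment> \<open>Entry number \<open>length h\<close> of a later history is the choice that Eve made at \<open>h\<close>.\<close>
  define \<sigma> where "\<sigma> g = (if g ! length h then \<sigma>1 g else \<sigma>2 g)" for g
  have "outcome M \<sigma> \<tau> (h @ [True]) \<psi> w = outcome M \<sigma>1 \<tau> (h @ [True]) \<psi> w"
    "outcome M \<sigma> \<tau> (h @ [False]) \<theta> w = outcome M \<sigma>2 \<tau> (h @ [False]) \<theta> w" for \<tau>
    by (rule outcome_cong; simp add: \<sigma>_def)+
  then have "outcome M \<sigma> \<tau> h (Conj \<psi> \<theta>) w \<in> alt_accepting M" for \<tau>
    using 1 2 by simp
  then show ?case by blast
next
  case (Disj \<psi> \<theta>)
  define c where "c = holds (accepts_from M w) \<psi>"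
  obtain \<sigma>1 where 1: "\<And>\<tau>. outcome M \<sigma>1 \<tau> (h @ [c]) (if c then \<psi> else \<theta>) w \<in> alt_accepting M"
    using Disj.IH(1)[of "h @ [c]"] Disj.IH(2)[of "h @ [c]"] Disj.prems
    by (cases c) (auto simp: c_def)
  define \<sigma> where "\<sigma> = \<sigma>1(h := c)"
  have "outcome M \<sigma> \<tau> (h @ [c]) \<phi> w = outcome M \<sigma>1 \<tau> (h @ [c]) \<phi> w" for \<tau> \<phi>
    by (rule outcome_cong) (simp_all add: \<sigma>_def)
  then have "outcome M \<sigma> \<tau> h (Disj \<psi> \<theta>) w \<in> alt_accepting M" for \<tau>
    using 1[of \<tau>] by (simp add: \<sigma>_def split: if_splits)
  then show ?case by blast
qed

text \<open>
  Only a reply \<open>\<tau>\<close> to the given \<open>\<sigma>\<close> is needed here, so at a disjunction the choice has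
  already been made and no gluing occurs.
\<close>

lemma eve_wins_outcome:
  assumes play: "\<And>s h. \<not> accepts_from M w s \<Longrightarrow> \<exists>\<tau>. play_from M \<sigma> \<tau> h s w \<notin> alt_accepting M"
    and "\<not> holds (accepts_from M w) \<phi>"
  shows "\<exists>\<tau>. outcome M \<sigma> \<tau> h \<phi> w \<notin> alt_accepting M"
  using assms(2)
proof (induction \<phi> arbitrary: h)
  case (Atom s)
  then show ?case using play by simp
next
  case (Conj \<psi> \<theta>)
  define c where "c = (\<not> holds (accepts_from M w) \<psi>)"
  obtain \<tau>1 where 1: "outcome M \<sigma> \<tau>1 (h @ [c]) (if c then \<psi> else \<theta>) w \<notin> alt_accepting M"
    using Conj.IH(1)[of "h @ [c]"] Conj.IH(2)[of "h @ [c]"] Conj.prems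
    by (cases c) (auto simp: c_def)
  define \<tau> where "\<tau> = \<tau>1(h := c)"
  have "outcome M \<sigma> \<tau> (h @ [c]) \<phi> w = outcome M \<sigma> \<tau>1 (h @ [c]) \<phi> w" for \<phi>
    by (rule outcome_cong) (simp_all add: \<tau>_def)
  then have "outcome M \<sigma> \<tau> h (Conj \<psi> \<theta>) w \<notin> alt_accepting M"
    using 1 by (simp add: \<tau>_def split: if_splits)
  then show ?case by blast
next
  case (Disj \<psi> \<theta>)
  then show ?case by (cases "\<sigma> h") auto
qed

text \<open>
  The game is determined: acceptance is the value of the nested boolean formulas obtained by
  substituting backwards from the last letter.
\<close>

lemma alt_accepts_iff: "alt_accepts M w \<longleftrightarrow> accepts_from M w (alt_start M)"
proof -
  have "accepts_from M w s \<Longrightarrow> \<exists>\<sigma>. \<forall>\<tau>. play_from M \<sigma> \<tau> h s w \<in> alt_accepting M" for s h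
  proof (induction w arbitrary: h s)
    case (Cons a w)
    then show ?case unfolding play_from_Cons by (intro alice_wins_outcome) auto
  qed simp
  moreover have "\<not> accepts_from M w s \<Longrightarrow> \<exists>\<tau>. play_from M \<sigma> \<tau> h s w \<notin> alt_accepting M" for s h \<sigma>
  proof (induction w arbitrary: h s)
    case (Cons a w)
    then show ?case unfolding play_from_Cons by (intro eve_wins_outcome) auto
  qed simp
  ultimately show ?thesis
    unfolding alt_accepts_def play_result_def by blast
qed

fun states_after :: "('a, 's) alt_automaton \<Rightarrow> 's \<Rightarrow> 'a list \<Rightarrow> 's set" where
  "states_after M s [] = {s}"
| "states_after M s (a # u) = (\<Union>s'\<in>set_pos_formula (alt_trans M a s). states_after M s' u)"

text \<open>
  Suffixes that the states reached after \<open>u\<close> do not distinguish are interchangeable, because the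
  truth value at \<open>s\<close> is a boolean combination of the truth values at these states.
\<close>

lemma accepts_from_append_cong:
  assumes "\<And>s'. s' \<in> states_after M s u \<Longrightarrow> accepts_from M v s' = accepts_from M v' s'"
  shows "accepts_from M (u @ v) s = accepts_from M (u @ v') s"
  using assms
proof (induction u arbitrary: s)
  case (Cons a u)
  have "accepts_from M (u @ v) s' = accepts_from M (u @ v') s'"
    if "s' \<in> set_pos_formula (alt_trans M a s)" for s'
    using that Cons.prems by (intro Cons.IH) auto
  then show ?case by (simp cong: holds_cong)
qed simp

text \<open>
  Any atom can be reached by following the branch leading to it. The required choices are given to
  both players as a list \<open>c\<close> that is consulted by the length of the history alone; such strategies
  compose by concatenating lists, with no need to track the histories themselves.
\<close>

lemma resolve_by_length:
  assumes "s \<in> set_pos_formula \<phi>"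
  shows "\<exists>c. \<forall>f h. (\<forall>i<length c. f (length h + i) = c ! i) \<longrightarrow>
           resolve (\<lambda>g. f (length g)) (\<lambda>g. f (length g)) h \<phi> = (h @ c, s)"
  using assms
proof (induction \<phi>)
  case (Atom x)
  then show ?case by (intro exI[of _ "[]"]) simp
next
  case (Conj \<psi> \<theta>)
  then obtain b c where c: "\<And>f h. (\<forall>i<length c. f (length h + i) = c ! i) \<longrightarrow>
      resolve (\<lambda>g. f (length g)) (\<lambda>g. f (length g)) h (if b then \<psi> else \<theta>) = (h @ c, s)"
    by (smt (verit) UnE pos_formula.set(2))
  show ?case
  proof (intro exI[of _ "b # c"] allI impI)
    fix f :: "nat \<Rightarrow> bool" and h :: "bool list"
    assume f: "\<forall>i<length (b # c). f (length h + i) = (b # c) ! i"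
    have "f (length h) = b" using f[rule_format, of 0] by simp
    moreover have "\<forall>i<length c. f (length (h @ [b]) + i) = c ! i"
      using f[rule_format, of "Suc _"] by simp
    ultimately show "resolve (\<lambda>g. f (length g)) (\<lambda>g. f (length g)) h (Conj \<psi> \<theta>) = (h @ b # c, s)"
      using c[rule_format, of f "h @ [b]"] by simp
  qed
next
  case (Disj \<psi> \<theta>)
  then obtain b c where c: "\<And>f h. (\<forall>i<length c. f (length h + i) = c ! i) \<longrightarrow>
      resolve (\<lambda>g. f (length g)) (\<lambda>g. f (length g)) h (if b then \<psi> else \<theta>) = (h @ c, s)"
    by (smt (verit) UnE pos_formula.set(3))
  show ?case
  proof (intro exI[of _ "b # c"] allI impI)
    fix f :: "nat \<Rightarrow> bool" and h :: "bool list"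
    assume f: "\<forall>i<length (b # c). f (length h + i) = (b # c) ! i"
    have "f (length h) = b" using f[rule_format, of 0] by simp
    moreover have "\<forall>i<length c. f (length (h @ [b]) + i) = c ! i"
      using f[rule_format, of "Suc _"] by simp
    ultimately show "resolve (\<lambda>g. f (length g)) (\<lambda>g. f (length g)) h (Disj \<psi> \<theta>) = (h @ b # c, s)"
      using c[rule_format, of f "h @ [b]"] by simp
  qed
qed

lemma play_from_by_length:
  assumes "s' \<in> states_after M s u"
  shows "\<exists>c. \<forall>f h. (\<forall>i<length c. f (length h + i) = c ! i) \<longrightarrow>
           play_from M (\<lambda>g. f (length g)) (\<lambda>g. f (length g)) h s u = s'"
  using assms
proof (induction u arbitrary: s)
  case (Cons a u)
  then obtain t where t: "t \<in> set_pos_formula (alt_trans M a s)" "s' \<in> states_after M t u" by auto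
  obtain c where c: "\<And>f h. (\<forall>i<length c. f (length h + i) = c ! i) \<Longrightarrow>
      resolve (\<lambda>g. f (length g)) (\<lambda>g. f (length g)) h (alt_trans M a s) = (h @ c, t)"
    using resolve_by_length[OF t(1)] by blast
  obtain d where d: "\<And>f h. (\<forall>i<length d. f (length h + i) = d ! i) \<Longrightarrow>
      play_from M (\<lambda>g. f (length g)) (\<lambda>g. f (length g)) h t u = s'"
    using Cons.IH[OF t(2)] by blast
  show ?case
  proof (intro exI[of _ "c @ d"] allI impI)
    fix f :: "nat \<Rightarrow> bool" and h :: "bool list"
    assume f: "\<forall>i<length (c @ d). f (length h + i) = (c @ d) ! i"
    have "f (length h + i) = c ! i" if "i < length c" for i
      using f[rule_format, of i] that by (simp add: nth_append)
    moreover have "f (length (h @ c) + i) = d ! i" if "i < length d" for i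
      using f[rule_format, of "length c + i"] that by (simp add: nth_append add.assoc)
    ultimately show "play_from M (\<lambda>g. f (length g)) (\<lambda>g. f (length g)) h s (a # u) = s'"
      using c[of f h] d[of f "h @ c"] by simp
  qed
qed auto

lemma states_after_subset_reachable:
  assumes "length u \<le> n"
  shows "states_after M (alt_start M) u \<subseteq> alt_reachable_upto M n"
proof
  fix s' assume "s' \<in> states_after M (alt_start M) u"
  from play_from_by_length[OF this] obtain c where
    c: "\<forall>f h. (\<forall>i<length c. f (length h + i) = c ! i) \<longrightarrow>
      play_from M (\<lambda>g. f (length g)) (\<lambda>g. f (length g)) h (alt_start M) u = s'" ..
  let ?\<rho> = "\<lambda>g. c ! length g"
  have "play_from M ?\<rho> ?\<rho> [] (alt_start M) u = s'"
    by (rule c[rule_format, of "(!) c" "[]"]) simp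
  then have "s' = play_result M ?\<rho> ?\<rho> u" by (simp add: play_result_def)
  then show "s' \<in> alt_reachable_upto M n"
    unfolding alt_reachable_upto_def using assms by blast
qed

text \<open>
  The lower bound principle for alternating automata: the residual of \<open>v\<close>, restricted to prefixes of
  length at most \<open>n\<close>, is determined by the set of reachable states from which \<open>v\<close> is accepted.
\<close>

theorem card_residuals_le:
  fixes L :: "'a::finite list set"
  shows "finite ((\<lambda>v. {u. length u \<le> n \<and> u @ v \<in> L}) ` V)" (is "finite (?col ` V)")
    and "card ((\<lambda>v. {u. length u \<le> n \<and> u @ v \<in> L}) ` V) \<le> 2 ^ alt_state_complexity L n"
proof -
  from is_alt_state_complexity(1)[of L n] obtain M :: "('a, nat) alt_automaton"
    where "alt_wf M \<and> alt_recognizes M L \<and>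
      card (alt_reachable_upto M n) = alt_state_complexity L n" ..
  then have M: "alt_recognizes M L"
    and card: "card (alt_reachable_upto M n) = alt_state_complexity L n"
    by simp_all
  let ?R = "alt_reachable_upto M n"
  let ?sig = "\<lambda>v. {s \<in> ?R. accepts_from M v s}"
  have L: "w \<in> L \<longleftrightarrow> accepts_from M w (alt_start M)" for w
    using M unfolding alt_recognizes_def alt_accepts_iff[symmetric] by blast
  have eq: "?col v = ?col v'" if sig: "?sig v = ?sig v'" for v v'
  proof -
    have "u @ v \<in> L \<longleftrightarrow> u @ v' \<in> L" if u: "length u \<le> n" for u
      unfolding L
    proof (rule accepts_from_append_cong)
      fix s assume "s \<in> states_after M (alt_start M) u"
      then have "s \<in> ?R" using states_after_subset_reachable[OF u] by (rule rev_subsetD)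
      then show "accepts_from M v s = accepts_from M v' s" using sig by blast
    qed
    then show ?thesis by blast
  qed
  have fin: "finite (Pow ?R)" by (simp add: finite_alt_reachable_upto)
  \<comment> \<open>The map that recovers a residual from a set of accepting states.\<close>
  define pick where "pick X = ?col (SOME v. v \<in> V \<and> ?sig v = X)" for X
  have pick: "?col v = pick (?sig v)" if "v \<in> V" for v
  proof -
    have "?sig (SOME v'. v' \<in> V \<and> ?sig v' = ?sig v) = ?sig v"
      by (rule someI2[of _ v]) (simp_all add: that)
    then show ?thesis unfolding pick_def by (rule eq[OF sym])
  qed
  have sub: "?col ` V \<subseteq> pick ` Pow ?R"
  proof (rule image_subsetI)
    fix v assume "v \<in> V"
    then show "?col v \<in> pick ` Pow ?R" unfolding pick[OF \<open>v \<in> V\<close>] by (intro imageI) simp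
  qed
  then show "finite (?col ` V)" by (rule finite_subset) (rule finite_imageI[OF fin])
  have "card (?col ` V) \<le> card (pick ` Pow ?R)"
    using finite_imageI[OF fin] sub by (rule card_mono)
  also have "\<dots> \<le> card (Pow ?R)" using fin by (rule card_image_le)
  also have "\<dots> = 2 ^ alt_state_complexity L n"
    by (simp only: card_Pow finite_alt_reachable_upto card)
  finally show "card (?col ` V) \<le> 2 ^ alt_state_complexity L n" .
qed

lemma alt_le_det_state_complexity:
  fixes L :: "'a::finite list set"
  shows "alt_state_complexity L n \<le> det_state_complexity L n"
proof -
  from is_det_state_complexity(1)[of L n] obtain M :: "('a, nat) det_automaton"
    where "det_wf M \<and> det_recognizes M L \<and>
      card (det_reachable_upto M n) = det_state_complexity L n" ..
  then have M: "det_wf M" "det_recognizes M L"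
    and card: "card (det_reachable_upto M n) = det_state_complexity L n"
    by simp_all
  define N where "N = \<lparr>alt_states = det_states M, alt_start = det_start M,
    alt_accepting = det_accepting M, alt_trans = (\<lambda>a s. Atom (det_trans M s a))\<rparr>"
  have "play_from N \<sigma> \<tau> h s w = foldl (det_trans M) s w" for \<sigma> \<tau> h s w
    by (induction w arbitrary: s) (simp_all add: N_def)
  then have play: "play_result N \<sigma> \<tau> w = det_reached M w" for \<sigma> \<tau> w
    by (simp add: play_result_def det_reached_def N_def)
  have "alt_wf N" using M(1) by (auto simp: alt_wf_def det_wf_def N_def)
  moreover have "alt_recognizes N L"
    using M(2) by (simp add: alt_recognizes_def det_recognizes_def alt_accepts_def play)
      (simp add: N_def)
  ultimately have "alt_state_complexity L n \<le> card (alt_reachable_upto N n)"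
    by (rule is_alt_state_complexity(2))
  also have "alt_reachable_upto N n = det_reachable_upto M n"
    by (simp add: alt_reachable_upto_def det_reachable_upto_def play)
  finally show ?thesis by (simp add: card)
qed

lemma det_state_complexity_le_card_words:
  fixes L :: "'a::finite list set"
  shows "det_state_complexity L n \<le> card {w :: 'a list. length w \<le> n}"
proof -
  define M where "M = \<lparr>det_states = UNIV, det_start = [], det_accepting = L,
     det_trans = (\<lambda>w a. w @ [a])\<rparr>"
  have reached: "det_reached M w = w" for w
    by (induction w rule: rev_induct) (simp_all add: M_def det_reached_def)
  have "det_wf M" "det_recognizes M L"
    by (simp_all add: det_wf_def det_recognizes_def reached) (simp_all add: M_def)
  then have "det_state_complexity L n \<le> card (det_reachable_upto M n)"
    by (rule is_det_state_complexity(2))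
  then show ?thesis by (simp add: det_reachable_upto_def reached)
qed

lemma det_state_complexity_binary_le:
  fixes L :: "bool list set"
  shows "det_state_complexity L n \<le> 2 ^ (n + 1)"
proof -
  have "card {w :: bool list. length w \<le> n} = (\<Sum>i\<le>n. 2 ^ i)"
    using card_lists_length_le[of "UNIV :: bool set" n] by simp
  also have "\<dots> \<le> 2 ^ (n + 1)"
    by (induction n) auto
  finally show ?thesis using det_state_complexity_le_card_words order_trans by blast
qed

lemma alt_state_complexity_pos:
  fixes L :: "'a::finite list set"
  shows "0 < alt_state_complexity L n"
proof -
  from is_alt_state_complexity(1)[of L n] obtain M :: "('a, nat) alt_automaton"
    where "alt_wf M \<and> alt_recognizes M L \<and>
      card (alt_reachable_upto M n) = alt_state_complexity L n" ..
  then have card: "card (alt_reachable_upto M n) = alt_state_complexity L n"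
    by simp
  have "alt_start M \<in> alt_reachable_upto M n"
    using states_after_subset_reachable[of "[]" n M] by simp
  then have "card (alt_reachable_upto M n) > 0"
    by (subst card_gt_0_iff) (auto simp: finite_alt_reachable_upto)
  then show ?thesis unfolding card .
qed


section \<open>Columns of an arithmetic language\<close>

definition column :: "(nat \<Rightarrow> bool) \<Rightarrow> nat \<Rightarrow> nat \<Rightarrow> nat set" where
  "column Q n b = {a. a < 2 ^ n \<and> Q (a + 2 ^ n * b)}"

lemma finite_column [simp]: "finite (column Q n b)"
  by (rule finite_subset[of _ "{..<2 ^ n}"]) (auto simp: column_def)

lemma lsd_expansion_iff:
  "lsd_expansion w m \<longleftrightarrow> w \<noteq> [] \<and> last w \<and> m = horner_sum of_bool 2 w"
  by (simp add: lsd_expansion_def horner_sum_eq_sum atLeast0LessThan)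

lemma ex_lsd_expansion:
  assumes "b > 0"
  shows "\<exists>w. lsd_expansion w b"
  using assms
proof (induction b rule: less_induct)
  case (less b)
  show ?case
  proof (cases "b = 1")
    case True
    then show ?thesis by (intro exI[of _ "[True]"]) (simp add: lsd_expansion_iff)
  next
    case False
    then have "b div 2 > 0" "b div 2 < b" using less.prems by auto
    then obtain w where "lsd_expansion w (b div 2)" using less.IH by blast
    then have "lsd_expansion ((b mod 2 = 1) # w) b"
      by (auto simp: lsd_expansion_iff of_bool_def) presburger
    then show ?thesis by blast
  qed
qed

text \<open>
  The first \<open>n\<close> digits of \<open>a + 2 ^ n * b\<close> spell \<open>a\<close>, padded with zeros, and the remaining ones are
  the expansion of \<open>b\<close>; positivity of \<open>b\<close> guarantees a leading digit 1. So columns are images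
  of residuals.
\<close>

lemma card_columns_le:
  fixes Q :: "nat \<Rightarrow> bool"
  assumes L: "L = {w. \<exists>m. Q m \<and> lsd_expansion w m}" and B: "\<And>b. b \<in> B \<Longrightarrow> b > 0"
  shows "finite (column Q n ` B)"
    and "card (column Q n ` B) \<le> 2 ^ alt_state_complexity L n"
proof -
  define word where "word b = (SOME w. lsd_expansion w b)" for b
  have word: "lsd_expansion (word b) b" if "b \<in> B" for b
    unfolding word_def using ex_lsd_expansion[OF B[OF that]] by (rule someI_ex)
  define digits where "digits a = map (bit a) [0..<n]" for a :: nat
  define dec where "dec X = {a. a < 2 ^ n \<and> digits a \<in> X}" for X
  let ?col = "\<lambda>v. {u. length u \<le> n \<and> u @ v \<in> L}"
  have "column Q n b = dec (?col (word b))" if "b \<in> B" for b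
  proof -
    have "digits a @ word b \<in> L \<longleftrightarrow> Q (a + 2 ^ n * b)" if "a < 2 ^ n" for a
    proof -
      have "horner_sum of_bool 2 (digits a) = a"
        using that unfolding digits_def horner_sum_bit_eq_take_bit
        by (simp add: take_bit_nat_eq_self_iff)
      then show ?thesis
        using word[OF \<open>b \<in> B\<close>]
        by (auto simp: L lsd_expansion_iff horner_sum_append) (auto simp: digits_def)
    qed
    then show ?thesis by (auto simp: column_def dec_def) (auto simp: digits_def)
  qed
  then have sub: "column Q n ` B \<subseteq> dec ` ?col ` word ` B" by auto
  have fin: "finite (?col ` word ` B)" by (rule card_residuals_le)
  then show "finite (column Q n ` B)" using sub by (meson finite_imageI finite_subset)
  have "card (column Q n ` B) \<le> card (?col ` word ` B)"
    using sub fin by (meson card_image_le card_mono finite_imageI order_trans)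
  also have "\<dots> \<le> 2 ^ alt_state_complexity L n" by (rule card_residuals_le)
  finally show "card (column Q n ` B) \<le> 2 ^ alt_state_complexity L n" .
qed

section \<open>Squarefree numbers\<close>

definition odd_sqf_below :: "nat \<Rightarrow> nat set" where
  "odd_sqf_below n = {a. a < 2 ^ n \<and> odd a \<and> squarefree a}"

lemma finite_odd_sqf_below [simp]: "finite (odd_sqf_below n)"
  by (rule finite_subset[of _ "{..<2 ^ n}"]) (auto simp: odd_sqf_below_def)

text \<open>
  The term \<open>1 / (2 * j + 1)\<^sup>2\<close> is at most \<open>1 / (4 * j * (j + 1))\<close>, which telescopes.
\<close>

lemma sum_inverse_odd_squares: "(\<Sum>j\<in>{1..<K}. 1 / real (2 * j + 1) ^ 2) \<le> 1 / 4"
proof (cases "K = 0")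
  case False
  then have "1 \<le> K" by simp
  then have "(\<Sum>j\<in>{1..<K}. 1 / real (2 * j + 1) ^ 2) \<le> 1 / 4 - 1 / (4 * real K)"
  proof (induction K rule: dec_induct)
    case (step K)
    have "1 / real (2 * K + 1) ^ 2 \<le> 1 / (4 * real K) - 1 / (4 * real (Suc K))"
      using step.hyps by (simp add: divide_simps power2_eq_square) (simp add: algebra_simps)
    then show ?case using step by (simp add: atLeastLessThanSuc)
  qed simp
  then show ?thesis
    using False by (smt (verit) divide_nonneg_nonneg of_nat_0_le_iff)
qed simp

lemma sum_inverse_squares_above:
  assumes "K \<ge> 1"
  shows "(\<Sum>d\<in>{K<..r}. 1 / real d ^ 2) \<le> 1 / real K"
proof (cases "K \<le> r")
  case True
  then have "(\<Sum>d\<in>{K<..r}. 1 / real d ^ 2) \<le> 1 / real K - 1 / real r"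
  proof (induction r rule: dec_induct)
    case (step r)
    have "1 / real (Suc r) ^ 2 \<le> 1 / real r - 1 / real (Suc r)"
      using step.hyps assms by (simp add: divide_simps power2_eq_square)
    moreover have "{K<..Suc r} = insert (Suc r) {K<..r}" using step.hyps by auto
    ultimately show ?case using step by simp
  qed simp
  then show ?thesis by (smt (verit) divide_nonneg_nonneg of_nat_0_le_iff)
qed simp

lemma card_odd_below: "card {a. a < 2 ^ Suc n \<and> odd (a::nat)} = 2 ^ n"
proof -
  have "{a. a < 2 ^ Suc n \<and> odd a} = (\<lambda>j. 2 * j + 1) ` {..<2 ^ n :: nat}"
    by (auto elim!: oddE)
  then show ?thesis by (simp add: card_image inj_on_def)
qed

lemma card_multiples_below:
  assumes "q > 0"
  shows "card {a. 0 < a \<and> a < N \<and> q dvd a} \<le> N div (q::nat)"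
proof -
  have "{a. 0 < a \<and> a < N \<and> q dvd a} \<subseteq> (\<lambda>c. q * c) ` {1..N div q}"
  proof
    fix a assume "a \<in> {a. 0 < a \<and> a < N \<and> q dvd a}"
    then obtain c where "0 < q * c" "q * c < N" "a = q * c" by auto
    then show "a \<in> (\<lambda>c. q * c) ` {1..N div q}"
      unfolding \<open>a = q * c\<close> using assms by (intro imageI) (auto simp: less_eq_div_iff_mult_less_eq mult.commute Suc_le_eq)
  qed
  then have "card {a. 0 < a \<and> a < N \<and> q dvd a} \<le> card ((\<lambda>c. q * c) ` {1..N div q})"
    by (intro card_mono) auto
  also have "\<dots> \<le> N div q" using card_image_le[of "{1..N div q}" "\<lambda>c. q * c"] by simp
  finally show ?thesis .
qed

text \<open>
  An odd number that is not squarefree is divisible by the square of an odd number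
  \<open>2 * j + 1 \<ge> 3\<close>. The proportion of such numbers is at most the sum of the \<open>1 / (2 * j + 1)\<^sup>2\<close>, that
  is \<open>1 / 4\<close>, and half of all numbers are odd.
\<close>

lemma card_odd_sqf_below:
  assumes "n \<ge> 1"
  shows "2 ^ n \<le> 4 * card (odd_sqf_below n)"
proof -
  define N :: nat where "N = 2 ^ n"
  define M where "M j = {a. 0 < a \<and> a < N \<and> (2 * j + 1) ^ 2 dvd a}" for j :: nat
  have "{a. a < N \<and> odd a} \<subseteq> odd_sqf_below n \<union> (\<Union>j\<in>{1..<N}. M j)"
  proof clarify
    fix a assume a: "a < N" "odd a" "a \<notin> (\<Union>j\<in>{1..<N}. M j)"
    have "squarefree a"
    proof (rule ccontr)
      assume "\<not> squarefree a"
      then obtain x where x: "x ^ 2 dvd a" "\<not> x dvd 1" by (auto simp: squarefree_def)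
      have "odd x" using x(1) a(2) by (auto dest: dvd_trans)
      then obtain j where j: "x = 2 * j + 1" by (elim oddE)
      have "0 < a" using a(2) by (simp add: odd_pos)
      moreover have "x \<le> x ^ 2" by (simp add: power2_nat_le_imp_le)
      ultimately have "x \<le> a" using dvd_imp_le[OF x(1)] by linarith
      then have "j \<in> {1..<N}" using a(1) x(2) j by (cases j) auto
      then show False using a x(1) j \<open>0 < a\<close> by (auto simp: M_def)
    qed
    then show "a \<in> odd_sqf_below n" using a by (simp add: odd_sqf_below_def N_def)
  qed
  then have "card {a. a < N \<and> odd a} \<le> card (odd_sqf_below n \<union> (\<Union>j\<in>{1..<N}. M j))"
    by (intro card_mono) (auto simp: M_def)
  also have "\<dots> \<le> card (odd_sqf_below n) + card (\<Union>j\<in>{1..<N}. M j)" by (rule card_Un_le)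
  also have "\<dots> \<le> card (odd_sqf_below n) + (\<Sum>j\<in>{1..<N}. card (M j))"
    by (intro add_left_mono card_UN_le) simp
  finally have "card {a. a < N \<and> odd a} \<le> card (odd_sqf_below n) + (\<Sum>j\<in>{1..<N}. card (M j))" .
  moreover have "card {a. a < N \<and> odd a} = 2 ^ (n - 1)"
    using card_odd_below[of "n - 1"] assms by (simp add: N_def)
  moreover have "real (2 ^ (n - 1)) = real N / 2"
    using assms by (cases n) (simp_all add: N_def)
  moreover have "real (\<Sum>j\<in>{1..<N}. card (M j)) \<le> real N / 4"
  proof -
    have "real (card (M j)) \<le> real N * (1 / real (2 * j + 1) ^ 2)" for j
    proof -
      have "real (card (M j)) \<le> real (N div (2 * j + 1) ^ 2)"
        unfolding M_def by (intro of_nat_mono card_multiples_below) simp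
      also have "\<dots> \<le> real N / real ((2 * j + 1) ^ 2)" by (rule of_nat_div_le_of_nat)
      finally show ?thesis by (simp only: of_nat_power times_divide_eq_right mult_1_right)
    qed
    then have "real (\<Sum>j\<in>{1..<N}. card (M j)) \<le> (\<Sum>j\<in>{1..<N}. real N * (1 / real (2 * j + 1) ^ 2))"
      unfolding of_nat_sum by (intro sum_mono)
    also have "\<dots> = real N * (\<Sum>j\<in>{1..<N}. 1 / real (2 * j + 1) ^ 2)" by (simp add: sum_distrib_left)
    also have "\<dots> \<le> real N * (1 / 4)" by (intro mult_left_mono sum_inverse_odd_squares) simp
    finally show ?thesis by simp
  qed
  ultimately have "real N \<le> 4 * real (card (odd_sqf_below n))"
    by linarith
  then show ?thesis unfolding N_def by linarith
qed

lemma card_linear_congruence_le: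
  assumes "coprime \<beta> m" "m > (0::nat)"
  shows "card {t \<in> {1..Y}. m dvd \<alpha> + \<beta> * t} \<le> Y div m + 1"
proof -
  let ?S = "{t \<in> {1..Y}. m dvd \<alpha> + \<beta> * t}"
  have "inj_on (\<lambda>t. t div m) ?S"
  proof (rule inj_onI)
    fix t t' assume t: "t \<in> ?S" "t' \<in> ?S" "t div m = t' div m"
    then have "[\<alpha> + \<beta> * t = \<alpha> + \<beta> * t'] (mod m)" by (simp add: cong_def)
    then have "[t = t'] (mod m)"
      using assms(1) by (simp add: cong_add_lcancel_nat cong_mult_lcancel_nat)
    then show "t = t'" using t(3) by (metis cong_def div_mult_mod_eq)
  qed
  moreover have "(\<lambda>t. t div m) ` ?S \<subseteq> {0..Y div m}" by (auto intro: div_le_mono)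
  ultimately have "card ?S \<le> card {0..Y div m}" by (intro card_inj_on_le) auto
  then show ?thesis by simp
qed

lemma ex_dvd_linear:
  assumes "coprime N m" "m > (0::nat)"
  shows "\<exists>x. m dvd a + N * x"
proof -
  obtain x where x: "[N * x = Suc 0] (mod m)" using cong_solve_coprime_nat[OF assms(1)] by blast
  have "[N * x * (m * a - a) = Suc 0 * (m * a - a)] (mod m)" by (intro cong_mult x cong_refl)
  then have "[a + N * (x * (m * a - a)) = a + (m * a - a)] (mod m)"
    by (intro cong_add) (simp_all add: mult.assoc)
  moreover have "a + (m * a - a) = m * a" using assms(2) by (cases m) auto
  ultimately have "m dvd a + N * (x * (m * a - a))" by (simp add: cong_def mod_eq_0_iff_dvd)
  then show ?thesis by blast
qed

lemma not_squarefree_imp_prime_square: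
  assumes "\<not> squarefree (x::nat)"
  shows "\<exists>d. prime d \<and> d ^ 2 dvd x"
proof -
  obtain y where y: "y ^ 2 dvd x" "\<not> y dvd 1" using assms by (auto simp: squarefree_def)
  then obtain d where "prime d" "d dvd y" using prime_factor_nat[of y] by auto
  then show ?thesis using y(1) by (meson dvd_power_same dvd_trans)
qed

text \<open>
  Let \<open>N = 2 ^ n\<close>. The number \<open>b = x + W * t\<close> lies in a residue class modulo a product \<open>W\<close> of
  squares of primes, which settles all primes in \<open>A\<close>: the odd ones up to \<open>2 * N\<close>, for which
  \<open>q\<^sup>2 dvd b\<close>, and the private primes \<open>p a\<close> of the unwanted \<open>a\<close>. A private prime does no harm to
  another \<open>a\<close>, as differences of two candidates are smaller than its square. For the remaining
  primes \<open>d > 2 * N\<close>, the proportion of parameters \<open>t\<close> excluded by some \<open>d\<^sup>2\<close> is at most the sum of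
  the \<open>N / d\<^sup>2\<close>, which is at most \<open>1 / 2\<close>, up to one extra parameter for each pair \<open>(a, d)\<close>.
\<close>

lemma squarefree_patterns:
  assumes n: "n \<ge> 1" and T: "T \<subseteq> odd_sqf_below n"
  shows "\<exists>b>0. \<forall>a\<in>odd_sqf_below n. squarefree (a + 2 ^ n * b) \<longleftrightarrow> a \<in> T"
proof -
  define N :: nat where "N = 2 ^ n"
  define Q where "Q = odd_sqf_below n"
  have "even N" "N \<ge> 1" using n by (simp_all add: N_def)
  have Q: "a < N" "odd a" "squarefree a" if "a \<in> Q" for a
    using that by (auto simp: Q_def odd_sqf_below_def N_def)
  have coprime_N: "coprime N d" if "odd d" for d
    unfolding N_def using that by simp
  have "infinite {p::nat. prime p \<and> 2 * N < p}"
  proof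
    assume "finite {p::nat. prime p \<and> 2 * N < p}"
    then have "finite ({p::nat. prime p \<and> 2 * N < p} \<union> {..2 * N})" by simp
    then have "finite {p::nat. prime p}" by (rule rev_finite_subset) auto
    then show False using primes_infinite by simp
  qed
  from infinite_countable_subset[OF this] obtain p :: "nat \<Rightarrow> nat"
    where inj_p: "inj p" and range_p: "range p \<subseteq> {p. prime p \<and> 2 * N < p}" by blast
  have p: "prime (p a)" "2 * N < p a" for a using subsetD[OF range_p, of "p a"] by simp_all
  have odd_p: "odd (p a)" for a
    using p[of a] \<open>N \<ge> 1\<close> by (intro prime_odd_nat) auto
  have "\<exists>x. (p a) ^ 2 dvd a + N * x" for a
    using odd_p[of a] p(1)[of a] by (intro ex_dvd_linear coprime_N) (simp_all add: prime_gt_0_nat)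
  then have "\<forall>a. \<exists>x. (p a) ^ 2 dvd a + N * x" by simp
  from choice[OF this] obtain sol where sol: "(p a) ^ 2 dvd a + N * sol a" for a by blast
  define A where "A = {q. prime q \<and> odd q \<and> q \<le> 2 * N} \<union> p ` (Q - T)"
  have "finite A"
    by (rule finite_subset[of _ "{..2 * N} \<union> p ` Q"]) (auto simp: A_def Q_def)
  have primeA: "prime q" "odd q" if "q \<in> A" for q
    using that by (auto simp: A_def p(1) odd_p)
  define u where "u q = (if q \<le> 2 * N then 0 else sol (inv p q))" for q
  have "\<exists>x. \<forall>q\<in>A. [x = u q] (mod q ^ 2)"
  proof (rule chinese_remainder_nat[OF \<open>finite A\<close>], intro ballI impI)
    fix q q' assume "q \<in> A" "q' \<in> A" "q \<noteq> q'"
    then show "coprime (q ^ 2) (q' ^ 2)"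
      using primes_coprime[OF primeA(1) primeA(1), of q q'] by simp
  qed
  then obtain x where "\<forall>q\<in>A. [x = u q] (mod q ^ 2)" ..
  then have x: "[x = u q] (mod q ^ 2)" if "q \<in> A" for q using that by (rule bspec)
  define W where "W = (\<Prod>q\<in>A. q ^ 2)"
  have W: "q ^ 2 dvd W" if "q \<in> A" for q
    unfolding W_def by (rule dvd_prodI[OF \<open>finite A\<close> that])
  have "W \<ge> 1" unfolding W_def
  proof (rule prod_ge_1)
    fix q assume "q \<in> A"
    then show "1 \<le> q ^ 2" using prime_gt_0_nat[OF primeA(1)] by (simp add: Suc_leI)
  qed
  \<comment> \<open>\<open>Y\<close> is the length of the range of \<open>t\<close>. It is chosen such that \<open>C * Y = r\<^sup>2\<close> bounds all
    \<open>a + N * b\<close>, so only \<open>d \<le> r\<close> matter, and such that \<open>N * r = Y / 4\<close>.\<close>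
  define C where "C = N * (1 + x + W)"
  define r where "r = C * (4 * N)"
  define Y where "Y = C * (4 * N) ^ 2"
  have "C \<ge> 1" using \<open>N \<ge> 1\<close> by (simp add: C_def)
  have "Y \<ge> 1" using \<open>N \<ge> 1\<close> \<open>C \<ge> 1\<close> by (simp add: Y_def)
  define bad where "bad a d = {t \<in> {1..Y}. d ^ 2 dvd (a + N * x) + (N * W) * t}" for a d
  have finite_bad: "finite (bad a d)" for a d
    by (rule finite_subset[of _ "{1..Y}"]) (auto simp: bad_def)
  define D where "D = {d. prime d \<and> d \<in> {2 * N<..r} \<and> d \<notin> A}"
  have "finite D" by (rule finite_subset[of _ "{..r}"]) (auto simp: D_def)
  have card_bad: "real (card (bad a d)) \<le> real Y * (1 / real d ^ 2) + 1" if "d \<in> D" for a d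
  proof -
    have d: "prime d" "2 * N < d" "d \<notin> A" using that by (auto simp: D_def)
    have "odd d" using d \<open>N \<ge> 1\<close> by (intro prime_odd_nat) auto
    have "coprime (q ^ 2) (d ^ 2)" if "q \<in> A" for q
    proof -
      have "q \<noteq> d" using that d(3) by blast
      then show ?thesis using primes_coprime[OF primeA(1)[OF that] d(1)] by simp
    qed
    then have "coprime W (d ^ 2)" unfolding W_def by (intro prod_coprime_left)
    moreover have "coprime N (d ^ 2)" using \<open>odd d\<close> by (intro coprime_N) simp
    ultimately have "card (bad a d) \<le> Y div d ^ 2 + 1"
      unfolding bad_def using d(1) by (intro card_linear_congruence_le) (auto simp: prime_gt_0_nat)
    also have "real \<dots> \<le> real Y / real (d ^ 2) + 1"
      using of_nat_div_le_of_nat[of Y "d ^ 2"] by simp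
    finally show ?thesis by simp
  qed
  have "finite T" using T by (rule finite_subset) simp
  have "T \<subseteq> {..<N}" using T by (auto simp: odd_sqf_below_def N_def)
  then have "card T \<le> N" using card_mono[of "{..<N}" T] by simp
  have "real (card (\<Union>a\<in>T. \<Union>d\<in>D. bad a d)) \<le> (\<Sum>a\<in>T. \<Sum>d\<in>D. real (card (bad a d)))"
  proof -
    have "card (\<Union>a\<in>T. \<Union>d\<in>D. bad a d) \<le> (\<Sum>a\<in>T. card (\<Union>d\<in>D. bad a d))"
      by (rule card_UN_le) fact
    also have "\<dots> \<le> (\<Sum>a\<in>T. \<Sum>d\<in>D. card (bad a d))"
      by (intro sum_mono card_UN_le \<open>finite D\<close>)
    finally show ?thesis by (simp flip: of_nat_sum)
  qed
  also have "\<dots> \<le> (\<Sum>a\<in>T. \<Sum>d\<in>D. real Y * (1 / real d ^ 2) + 1)"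
    by (intro sum_mono card_bad)
  also have "\<dots> \<le> (\<Sum>a\<in>T. \<Sum>d\<in>{2 * N<..r}. real Y * (1 / real d ^ 2) + 1)"
    by (intro sum_mono sum_mono2) (auto simp: D_def)
  also have "\<dots> = real (card T) * (real Y * (\<Sum>d\<in>{2 * N<..r}. 1 / real d ^ 2) + real (r - 2 * N))"
    by (simp add: sum.distrib sum_distrib_left)
  also have "\<dots> \<le> real N * (real Y * (1 / real (2 * N)) + real r)"
  proof (rule mult_mono)
    show "real Y * (\<Sum>d\<in>{2 * N<..r}. 1 / real d ^ 2) + real (r - 2 * N)
        \<le> real Y * (1 / real (2 * N)) + real r"
      using \<open>N \<ge> 1\<close> by (intro add_mono mult_left_mono sum_inverse_squares_above) simp_all
    show "0 \<le> real Y * (\<Sum>d\<in>{2 * N<..r}. 1 / real d ^ 2) + real (r - 2 * N)"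
      by (intro add_nonneg_nonneg mult_nonneg_nonneg sum_nonneg) simp_all
  qed (use \<open>card T \<le> N\<close> in simp_all)
  also have "\<dots> = 3 / 4 * real Y"
  proof -
    have "real N * real r = real Y / 4" by (simp add: Y_def r_def power2_eq_square)
    moreover have "real N * (real Y * (1 / real (2 * N))) = real Y / 2"
      using \<open>N \<ge> 1\<close> by simp
    ultimately show ?thesis by (simp add: distrib_left)
  qed
  also have "\<dots> < real Y" using \<open>Y \<ge> 1\<close> by simp
  finally have "card (\<Union>a\<in>T. \<Union>d\<in>D. bad a d) < card {1..Y}" by simp
  moreover have "finite (\<Union>a\<in>T. \<Union>d\<in>D. bad a d)"
    using \<open>finite T\<close> \<open>finite D\<close> by (simp add: finite_bad)
  ultimately have "\<not> {1..Y} \<subseteq> (\<Union>a\<in>T. \<Union>d\<in>D. bad a d)"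
    by (meson card_mono linorder_not_le)
  then obtain t where t: "t \<in> {1..Y}" and good: "\<And>a d. a \<in> T \<Longrightarrow> d \<in> D \<Longrightarrow> t \<notin> bad a d"
    by blast
  define b where "b = x + W * t"
  have b_cong: "[b = u q] (mod q ^ 2)" if "q \<in> A" for q
  proof -
    have "[x + W * t = u q + 0] (mod q ^ 2)"
      using W[OF that] by (intro cong_add x that) (simp add: cong_0_iff)
    then show ?thesis by (simp add: b_def)
  qed
  have killed: "p a ^ 2 dvd a + N * b" if "a \<in> Q - T" for a
  proof -
    have "p a \<in> A" using that by (auto simp: A_def)
    moreover have "u (p a) = sol a" using p[of a] inj_p by (simp add: u_def)
    ultimately have "[a + N * b = a + N * sol a] (mod p a ^ 2)"
      using b_cong[of "p a"] by (intro cong_add cong_mult) auto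
    from cong_dvd_iff[OF cong_sym[OF this]] show ?thesis using sol by simp
  qed
  have "squarefree (a + N * b) \<longleftrightarrow> a \<in> T" if "a \<in> Q" for a
  proof
    assume "squarefree (a + N * b)"
    then have "\<not> p a ^ 2 dvd a + N * b"
      using prime_gt_1_nat[OF p(1)[of a]] by (metis dvd_1_iff_1 less_irrefl squarefreeD One_nat_def)
    then show "a \<in> T" using killed[of a] that by blast
  next
    assume "a \<in> T"
    show "squarefree (a + N * b)"
    proof (rule ccontr)
      assume "\<not> squarefree (a + N * b)"
      then obtain d where d: "prime d" "d ^ 2 dvd a + N * b"
        using not_squarefree_imp_prime_square by blast
      have "odd (a + N * b)" using Q(2)[OF that] \<open>even N\<close> by simp
      then have "odd d" using dvd_trans[OF _ d(2), of 2] by auto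
      consider "d \<le> 2 * N" | a' where "a' \<in> Q - T" "d = p a'" | "2 * N < d" "d \<notin> p ` (Q - T)"
        by force
      then show False
      proof cases
        case 1
        then have "d \<in> A" using d(1) \<open>odd d\<close> by (simp add: A_def)
        then have "[b = 0] (mod d ^ 2)" using b_cong[of d] 1 by (simp add: u_def)
        then have "d ^ 2 dvd a" using d(2) by (simp add: cong_0_iff dvd_add_left_iff)
        then show False using Q(3)[OF that] d(1) by (auto simp: squarefree_def)
      next
        case 2
        have "d ^ 2 dvd a' + N * b" using killed 2 by blast
        then have "[a + N * b = a' + N * b] (mod d ^ 2)"
          using d(2) by (simp add: cong_def mod_eq_0_iff_dvd)
        then have "[a = a'] (mod d ^ 2)" by (simp add: cong_add_rcancel_nat)
        moreover have "N < d ^ 2"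
        proof -
          have "N < d" using 2 p(2)[of a'] by simp
          also have "d \<le> d ^ 2" by (simp add: power2_nat_le_imp_le)
          finally show ?thesis .
        qed
        moreover have "a < N" "a' < N" using Q that 2 by auto
        ultimately have "a = a'" by (intro cong_less_modulus_unique_nat[of a a' "d ^ 2"]) simp_all
        then show False using \<open>a \<in> T\<close> 2 by blast
      next
        case 3
        have "a + N * b \<le> N * 1 + N * (x + W * Y)"
          using Q(1)[OF that] t unfolding b_def by (intro add_mono mult_le_mono) auto
        also have "\<dots> = N * (1 + x + W * Y)" by (simp add: algebra_simps)
        also have "\<dots> \<le> N * ((1 + x + W) * Y)"
          using mult_left_mono[OF \<open>Y \<ge> 1\<close>, of "1 + x"] by (intro mult_left_mono) (auto simp: distrib_right)
        also have "\<dots> = C * Y" by (simp add: C_def algebra_simps)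
        also have "\<dots> = r ^ 2" by (simp add: Y_def r_def power2_eq_square algebra_simps)
        finally have "a + N * b \<le> r ^ 2" .
        moreover have "d ^ 2 \<le> a + N * b"
          using d(2) \<open>odd (a + N * b)\<close> by (intro dvd_imp_le) (auto intro: odd_pos)
        ultimately have "d \<le> r" by (meson order_trans power2_nat_le_eq_le)
        then have "d \<in> D" using 3 d(1) by (simp add: D_def A_def)
        moreover have "t \<in> bad a d" using t d(2) by (simp add: bad_def b_def algebra_simps)
        ultimately show False using good \<open>a \<in> T\<close> by blast
      qed
    qed
  qed
  moreover have "b > 0" using t \<open>W \<ge> 1\<close> by (simp add: b_def)
  ultimately show ?thesis unfolding Q_def N_def by blast
qed

text \<open>
  All \<open>2 ^ card (odd_sqf_below n)\<close> traces occur, so there are at least as many columns.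
\<close>

theorem alt_state_complexity_sqf_ge:
  assumes "n \<ge> 1"
  shows "card (odd_sqf_below n) \<le> alt_state_complexity L_sqf n"
proof -
  let ?Q = "odd_sqf_below n" and ?B = "{b::nat. b > 0}"
  have "Pow ?Q \<subseteq> (\<lambda>X. X \<inter> ?Q) ` column squarefree n ` ?B"
  proof
    fix T assume "T \<in> Pow ?Q"
    then obtain b where b: "b > 0" "\<forall>a\<in>?Q. squarefree (a + 2 ^ n * b) \<longleftrightarrow> a \<in> T"
      using squarefree_patterns[OF assms] by blast
    then have "column squarefree n b \<inter> ?Q = T"
      using \<open>T \<in> Pow ?Q\<close> by (auto simp: column_def odd_sqf_below_def)
    then show "T \<in> (\<lambda>X. X \<inter> ?Q) ` column squarefree n ` ?B" using b(1) by blast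
  qed
  moreover have fin: "finite (column squarefree n ` ?B)"
    and le: "card (column squarefree n ` ?B) \<le> 2 ^ alt_state_complexity L_sqf n"
    by (rule card_columns_le[OF L_sqf_def]; simp)+
  ultimately have "card (Pow ?Q) \<le> card (column squarefree n ` ?B)"
    by (meson card_image_le card_mono finite_imageI order_trans)
  then have "2 ^ card ?Q \<le> (2::nat) ^ alt_state_complexity L_sqf n"
    using le by (simp add: card_Pow order_trans[OF _ le])
  then show ?thesis by simp
qed

section \<open>Prime counts\<close>

definition prime_count :: "nat \<Rightarrow> nat" where
  "prime_count x = card {p. prime p \<and> p \<le> x}"

lemma finite_primes_upto [simp]: "finite {p::nat. prime p \<and> p \<le> x}"
  by (rule finite_subset[of _ "{..x}"]) auto

text \<open>
  The product of the largest prime powers not exceeding \<open>x\<close>, one for each prime; it is in fact the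
  least common multiple of \<open>1, \<dots>, x\<close>.
\<close>

lemma ex_common_multiple_le_power_prime_count:
  assumes "x \<ge> 1"
  shows "\<exists>D>0. (\<forall>i\<in>{1..x}. i dvd D) \<and> D \<le> x ^ prime_count x"
proof -
  have "\<exists>e. p ^ e \<le> x \<and> x < p ^ (e + 1)" if "prime p" for p :: nat
    using ex_power_ivl1[of p x] prime_ge_2_nat[OF that] assms by simp
  then have "\<forall>p. \<exists>e. prime (p::nat) \<longrightarrow> p ^ e \<le> x \<and> x < p ^ (e + 1)" by simp
  from choice[OF this] obtain e :: "nat \<Rightarrow> nat"
    where e: "\<forall>p. prime p \<longrightarrow> p ^ e p \<le> x \<and> x < p ^ (e p + 1)" ..
  let ?P = "{p. prime p \<and> p \<le> x}"
  define D where "D = (\<Prod>p\<in>?P. p ^ e p)"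
  have "D > 0" unfolding D_def by (intro prod_pos) (auto simp: prime_gt_0_nat)
  moreover have "i dvd D" if i: "i \<in> {1..x}" for i
  proof -
    have "prime_factors i \<subseteq> ?P"
      using i by (auto simp: in_prime_factors_iff intro: order_trans[OF dvd_imp_le])
    have "multiplicity p i \<le> e p" if p: "prime p" for p
    proof -
      have "p ^ multiplicity p i \<le> i" using i by (intro dvd_imp_le multiplicity_dvd) simp
      also have "\<dots> < p ^ (e p + 1)" using i e p by (auto intro: le_less_trans)
      finally have "multiplicity p i < e p + 1"
        by (rule power_less_imp_less_exp[OF prime_gt_1_nat[OF p]])
      then show ?thesis by simp
    qed
    have "i = (\<Prod>p\<in>prime_factors i. p ^ multiplicity p i)"
      using i by (simp add: prime_factorization_nat)
    also have "\<dots> dvd (\<Prod>p\<in>prime_factors i. p ^ e p)"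
      using \<open>\<And>p. prime p \<Longrightarrow> multiplicity p i \<le> e p\<close>
      by (intro prod_dvd_prod le_imp_power_dvd) (simp add: in_prime_factors_iff)
    also have "\<dots> dvd D"
      unfolding D_def using \<open>prime_factors i \<subseteq> ?P\<close> by (intro prod_dvd_prod_subset) simp_all
    finally show ?thesis .
  qed
  moreover have "D \<le> x ^ prime_count x"
  proof -
    have "D \<le> (\<Prod>p\<in>?P. x)" unfolding D_def using e by (intro prod_mono) simp
    then show ?thesis by (simp add: prime_count_def)
  qed
  ultimately show ?thesis by blast
qed

text \<open>
  The numbers \<open>1 / (Suc n * (n choose m))\<close> form Leibniz's harmonic triangle, in which each entry is
  the difference of two entries of the preceding column. Starting from the entries \<open>1 / Suc n\<close>
  of the first column, induction shows that \<open>D\<close> times any entry is an integer.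
\<close>

lemma Suc_times_binomial_dvd:
  assumes D: "\<And>i. 1 \<le> i \<Longrightarrow> i \<le> x \<Longrightarrow> i dvd (D::nat)"
  shows "m \<le> n \<Longrightarrow> n < x \<Longrightarrow> Suc n * (n choose m) dvd D"
proof (induction m arbitrary: n)
  case 0
  then show ?case using D[of "Suc n"] by simp
next
  case (Suc m)
  then obtain l where l: "n = Suc l" "m \<le> l" by (cases n) auto
  define B where "B = real (l choose m)"
  have "B > 0" using l by (simp add: B_def)
  define x1 x2 x3 where "x1 = Suc l * (l choose m)" and "x2 = Suc n * (n choose m)"
    and "x3 = Suc n * (n choose Suc m)"
  have "x1 dvd D" unfolding x1_def using Suc.prems l by (intro Suc.IH) auto
  then obtain k1 where k1: "D = x1 * k1" by (elim dvdE)
  have "x2 dvd D" unfolding x2_def using Suc.prems l by (intro Suc.IH) auto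
  then obtain k2 where k2: "D = x2 * k2" by (elim dvdE)
  have b1: "real (n choose Suc m) = B * (l + 1) / (m + 1)"
  proof -
    have "real (Suc l * (l choose m)) = real ((n choose Suc m) * Suc m)"
      unfolding l(1) by (simp only: Suc_times_binomial_eq)
    then show ?thesis by (simp add: B_def field_simps)
  qed
  have b2: "real (n choose m) = B * (l + 1) / (l + 1 - real m)"
  proof -
    have "real (n - m) * real (n choose m) = real n * real (n - 1 choose m)"
      by (metis binomial_absorb_comp of_nat_mult)
    moreover have "real (n - m) = l + 1 - real m" using l by (simp add: of_nat_diff)
    ultimately have "(l + 1 - real m) * real (n choose m) = (l + 1) * B"
      using l by (simp add: B_def)
    then show ?thesis using l(2) by (simp add: field_simps)
  qed
  have pos: "real x1 > 0" "real x2 > 0" "real x3 > 0"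
    using l Suc.prems unfolding x1_def x2_def x3_def of_nat_0_less_iff nat_0_less_mult_iff
    by (simp_all only: zero_less_binomial_iff zero_less_Suc) simp_all
  have "1 / real x3 = 1 / real x1 - 1 / real x2"
  proof -
    have 1: "1 / real x1 = 1 / ((real l + 1) * B)" by (simp add: x1_def B_def algebra_simps)
    have 2: "1 / real x2 = (real l + 1 - real m) / ((real l + 2) * ((real l + 1) * B))"
      unfolding x2_def of_nat_mult b2 using l by (simp add: algebra_simps)
    have 3: "1 / real x3 = (real m + 1) / ((real l + 2) * ((real l + 1) * B))"
      unfolding x3_def of_nat_mult b1 using l by (simp add: algebra_simps)
    have 0: "1 / ((real l + 1) * B) = (real l + 2) / ((real l + 2) * ((real l + 1) * B))" by simp
    have "real m + 1 = (real l + 2) - (real l + 1 - real m)" by simp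
    then show ?thesis unfolding 1 2 3 0 by (simp only: diff_divide_distrib)
  qed
  then have "real D / real x3 = real D / real x1 - real D / real x2"
    by (metis (no_types) divide_inverse inverse_eq_divide right_diff_distrib)
  moreover have "real D / real x1 = real k1" using pos k1 by simp
  moreover have "real D / real x2 = real k2" using pos k2 by (metis nonzero_mult_div_cancel_left of_nat_mult less_irrefl)
  ultimately have "real D = real x3 * (real k1 - real k2)" using pos by (simp add: field_simps)
  then have "real_of_int (int D) = real_of_int (int x3 * (int k1 - int k2))" by simp
  then have "int D = int x3 * (int k1 - int k2)" by (simp only: of_int_eq_iff)
  then have "int x3 dvd int D" by simp
  then show ?case unfolding x3_def by (simp only: int_dvd_int_iff)
qed

text \<open>
  Chebyshev's bound: summing the estimate \<open>x * (x - 1 choose m) \<le> D\<close> over \<open>m\<close> bounds \<open>D\<close> below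
  by \<open>2 ^ (x - 1)\<close>, while \<open>D\<close> has a factor of at most \<open>x\<close> for each prime.
\<close>

lemma two_power_le_power_prime_count:
  assumes "x \<ge> 1"
  shows "2 ^ (x - 1) \<le> x ^ prime_count x"
proof -
  obtain D where D: "D > 0" "\<forall>i\<in>{1..x}. i dvd D" "D \<le> x ^ prime_count x"
    using ex_common_multiple_le_power_prime_count[OF assms] by auto
  have "x * (x - 1 choose m) \<le> D" if "m \<le> x - 1" for m
  proof -
    have "Suc (x - 1) * (x - 1 choose m) dvd D"
      using D(2) assms that by (intro Suc_times_binomial_dvd[of x]) auto
    then show ?thesis using D(1) assms by (intro dvd_imp_le) auto
  qed
  then have "(\<Sum>m\<le>x - 1. x * (x - 1 choose m)) \<le> (\<Sum>m\<le>x - 1. D)" by (intro sum_mono) simp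
  then have "x * 2 ^ (x - 1) \<le> x * D"
    using assms by (simp add: choose_row_sum flip: sum_distrib_left)
  then show ?thesis using assms D(3) by simp
qed

lemma prime_count_power_two_ge: "2 ^ j - 1 \<le> j * prime_count (2 ^ j)"
proof -
  have "2 ^ (2 ^ j - 1) \<le> (2::nat) ^ (j * prime_count (2 ^ j))"
    using two_power_le_power_prime_count[of "2 ^ j"] by (simp add: power_mult)
  then show ?thesis by simp
qed

text \<open>
  Primes above 3 are congruent to 1 or 5 modulo 6. The constant \<open>1 / 3\<close> is just good enough for
  \<open>sum_inverse_window_primes_ge_const\<close>; the constant \<open>1 / 2\<close> given by parity would not be.
\<close>

lemma prime_count_le: "prime_count x \<le> x div 3 + 3"
proof -
  have "{p. prime p \<and> p \<le> x} \<subseteq>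
    {2, 3} \<union> ((\<lambda>i. 6 * i + 1) ` {1..x div 6} \<union> (\<lambda>i. 6 * i + 5) ` {0..x div 6})"
  proof
    fix p assume "p \<in> {p. prime p \<and> p \<le> x}"
    then have p: "prime p" "p \<le> x" by auto
    define i where "i = p div 6"
    have i: "p = 6 * i + p mod 6" "i \<le> x div 6" using p by (auto simp: i_def div_le_mono)
    have two: "p = 2" if "2 dvd p" using primes_dvd_imp_eq[OF _ p(1) that] by simp
    have three: "p = 3" if "3 dvd p" using primes_dvd_imp_eq[OF _ p(1) that] by simp
    have "2 dvd p \<or> 3 dvd p \<or> p mod 6 = 1 \<or> p mod 6 = 5" by presburger
    then consider "2 dvd p" | "3 dvd p" | "p mod 6 = 1" | "p mod 6 = 5" by blast
    then show "p \<in> {2, 3} \<union> ((\<lambda>i. 6 * i + 1) ` {1..x div 6} \<union> (\<lambda>i. 6 * i + 5) ` {0..x div 6})"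
    proof cases
      case 3
      have "i \<noteq> 0" using p(1) i(1) 3 by (intro notI) simp
      then show ?thesis using i 3 by auto
    next
      case 4
      then show ?thesis using i by auto
    qed (use two three in auto)
  qed
  then have "prime_count x \<le> card ({2, 3} \<union> ((\<lambda>i. 6 * i + 1) ` {1..x div 6}
      \<union> (\<lambda>i. 6 * i + 5) ` {0..x div 6}))"
    unfolding prime_count_def by (rule card_mono[rotated]) simp
  also have "\<dots> \<le> card {2, 3 :: nat} + (card ((\<lambda>i. 6 * i + 1) ` {1..x div 6})
      + card ((\<lambda>i. 6 * i + 5) ` {0..x div 6}))"
    by (intro order_trans[OF card_Un_le] add_left_mono card_Un_le)
  also have "\<dots> \<le> 2 + (x div 6 + (x div 6 + 1))"
    by (intro add_mono order_trans[OF card_image_le]) simp_all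
  finally show ?thesis by linarith
qed

section \<open>The reciprocals of the primes in a window\<close>

definition window_primes :: "nat \<Rightarrow> nat \<Rightarrow> nat set" where
  "window_primes h n = {p. prime p \<and> 2 ^ h < p \<and> p < 2 ^ n}"

lemma finite_window_primes [simp]: "finite (window_primes h n)"
  by (rule finite_subset[of _ "{..<2 ^ n}"]) (auto simp: window_primes_def)

text \<open>
  This replaces \<open>1 / p\<close> by a sum over the dyadic scales above \<open>p\<close>, so that sums over primes become
  sums of prime counts at powers of two.
\<close>

lemma sum_dyadic_le_inverse:
  assumes "p > (0::nat)"
  shows "(\<Sum>j<n. if p \<le> 2 ^ j then 1 / 2 ^ (j + 1) else 0)
    \<le> (if p \<le> 2 ^ n then 1 / real p - 1 / 2 ^ n else 0)"
proof (induction n)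
  case 0
  then show ?case using assms by auto
next
  case (Suc n)
  consider "p \<le> 2 ^ n" | "2 ^ n < p" "p \<le> 2 ^ Suc n" | "2 ^ Suc n < p" by linarith
  then show ?case
  proof cases
    case 1
    then have "p \<le> 2 ^ Suc n" by simp
    moreover have "1 / 2 ^ n = 2 * (1 / 2 ^ (n + 1) :: real)" by simp
    ultimately show ?thesis using 1 Suc by (simp only: sum.lessThan_Suc if_True) simp
  next
    case 2
    then have "real p \<le> 2 ^ Suc n" using of_nat_mono[OF 2(2), where 'a = real] by simp
    then have "1 / 2 ^ Suc n \<le> 1 / real p" using assms by (intro divide_left_mono) auto
    then show ?thesis using 2 Suc by simp
  next
    case 3
    then have "\<not> p \<le> 2 ^ n" "\<not> p \<le> 2 ^ Suc n" by auto
    then show ?thesis using Suc by simp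
  qed
qed

text \<open>
  By partial summation over dyadic scales \<open>j\<close>, the sum is at least that of
  \<open>(prime_count (2 ^ j) - prime_count (2 ^ h)) / 2 ^ (j + 1)\<close>. By Chebyshev's bound the first part
  is at least about \<open>1 / (2 * n)\<close> for each \<open>j\<close>, and the second part adds up to at most
  \<open>prime_count (2 ^ h) / 2 ^ (h + 1)\<close>, roughly \<open>1 / 6\<close>.
\<close>

lemma sum_inverse_window_primes_ge:
  assumes "h < n"
  shows "real (n - h - 1) / (2 * real n) - 1 / 6 - 2 / 2 ^ h
    \<le> (\<Sum>p\<in>window_primes h n. 1 / real p)"
proof -
  let ?W = "window_primes h n" and ?J = "{h<..<n}"
  let ?t = "\<lambda>j. 1 / 2 ^ (j + 1) :: real"
  have term_le: "(\<Sum>j\<in>?J. if p \<le> 2 ^ j then ?t j else 0) \<le> 1 / real p" if "p \<in> ?W" for p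
  proof -
    have "p > 0" "p \<le> 2 ^ n" using that by (auto simp: window_primes_def prime_gt_0_nat)
    have "(\<Sum>j\<in>?J. if p \<le> 2 ^ j then ?t j else 0) \<le> (\<Sum>j<n. if p \<le> 2 ^ j then ?t j else 0)"
      by (intro sum_mono2) auto
    also have "\<dots> \<le> 1 / real p - 1 / 2 ^ n"
      using sum_dyadic_le_inverse[OF \<open>p > 0\<close>, of n] \<open>p \<le> 2 ^ n\<close> by simp
    also have "\<dots> \<le> 1 / real p" by simp
    finally show ?thesis .
  qed
  have card_ge: "real (prime_count (2 ^ j)) - real (prime_count (2 ^ h))
      \<le> real (card {p \<in> ?W. p \<le> 2 ^ j})" if "j \<in> ?J" for j
  proof -
    have "(2::nat) ^ j < 2 ^ n" using that by simp
    then have "{p. prime p \<and> p \<le> 2 ^ j} \<subseteq> {p. prime p \<and> p \<le> 2 ^ h} \<union> {p \<in> ?W. p \<le> 2 ^ j}"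
      by (auto simp: window_primes_def intro: le_less_trans)
    then have "prime_count (2 ^ j) \<le> card ({p. prime p \<and> p \<le> 2 ^ h} \<union> {p \<in> ?W. p \<le> 2 ^ j})"
      unfolding prime_count_def by (rule card_mono[rotated]) simp
    also have "\<dots> \<le> prime_count (2 ^ h) + card {p \<in> ?W. p \<le> 2 ^ j}"
      unfolding prime_count_def by (rule card_Un_le)
    finally show ?thesis by linarith
  qed
  have summand: "1 / (2 * real n) - ?t j * (1 + real (prime_count (2 ^ h)))
      \<le> ?t j * real (card {p \<in> ?W. p \<le> 2 ^ j})" if "j \<in> ?J" for j
  proof -
    have j: "real j > 0" "real j \<le> real n" using that by auto
    have "real (2 ^ j - 1) \<le> real (j * prime_count (2 ^ j))"
      by (intro of_nat_mono prime_count_power_two_ge)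
    then have "2 ^ j - 1 \<le> real j * real (prime_count (2 ^ j))" by (simp add: of_nat_diff)
    moreover have "2 ^ j / real j - 1 \<le> (2 ^ j - 1) / real j"
      using j that by (simp add: field_simps)
    ultimately have "2 ^ j / real j - 1 \<le> real (prime_count (2 ^ j))"
      using j by (smt (verit) pos_divide_le_eq mult.commute)
    moreover have "2 ^ j / real n \<le> 2 ^ j / real j" using j by (intro divide_left_mono) auto
    ultimately have "2 ^ j / real n - (1 + real (prime_count (2 ^ h)))
        \<le> real (card {p \<in> ?W. p \<le> 2 ^ j})"
      using card_ge[OF that] by linarith
    then have "?t j * (2 ^ j / real n - (1 + real (prime_count (2 ^ h))))
        \<le> ?t j * real (card {p \<in> ?W. p \<le> 2 ^ j})"
      by (intro mult_left_mono) auto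
    moreover have "?t j * (2 ^ j / real n) = 1 / (2 * real n)" by simp
    ultimately show ?thesis by (simp only: right_diff_distrib)
  qed
  have geom: "(\<Sum>j\<in>?J. ?t j) \<le> 1 / 2 ^ (h + 1)"
  proof -
    have "(\<Sum>j\<in>{h<..<Suc h + d}. ?t j) = 1 / 2 ^ (h + 1) - 1 / 2 ^ (Suc h + d)" for d
    proof (induction d)
      case 0
      have "{h<..<Suc h} = {}" by auto
      then show ?case by simp
    next
      case (Suc d)
      have "{h<..<Suc h + Suc d} = insert (Suc h + d) {h<..<Suc h + d}" by auto
      then have "(\<Sum>j\<in>{h<..<Suc h + Suc d}. ?t j)
          = ?t (Suc h + d) + (\<Sum>j\<in>{h<..<Suc h + d}. ?t j)" by simp
      moreover have "1 / 2 ^ (Suc h + d) = 2 * ?t (Suc h + d)" by simp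
      moreover have "?t (Suc h + d) = 1 / 2 ^ (Suc h + Suc d)" by simp
      ultimately show ?case using Suc by linarith
    qed
    from this[of "n - Suc h"] show ?thesis using assms by simp
  qed
  have "real (card ?J) * (1 / (2 * real n)) - (\<Sum>j\<in>?J. ?t j) * (1 + real (prime_count (2 ^ h)))
      = (\<Sum>j\<in>?J. 1 / (2 * real n) - ?t j * (1 + real (prime_count (2 ^ h))))"
    by (simp add: sum_subtractf sum_distrib_right)
  also have "\<dots> \<le> (\<Sum>j\<in>?J. ?t j * real (card {p \<in> ?W. p \<le> 2 ^ j}))"
    by (intro sum_mono summand)
  also have "\<dots> = (\<Sum>j\<in>?J. \<Sum>p\<in>?W. if p \<le> 2 ^ j then ?t j else 0)"
    by (intro sum.cong refl) (simp add: sum.inter_filter[symmetric])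
  also have "\<dots> = (\<Sum>p\<in>?W. \<Sum>j\<in>?J. if p \<le> 2 ^ j then ?t j else 0)" by (rule sum.swap)
  also have "\<dots> \<le> (\<Sum>p\<in>?W. 1 / real p)" by (intro sum_mono term_le)
  finally have main: "real (card ?J) * (1 / (2 * real n))
      - (\<Sum>j\<in>?J. ?t j) * (1 + real (prime_count (2 ^ h))) \<le> (\<Sum>p\<in>?W. 1 / real p)" .
  have "(\<Sum>j\<in>?J. ?t j) * (1 + real (prime_count (2 ^ h)))
      \<le> 1 / 2 ^ (h + 1) * (1 + (2 ^ h / 3 + 3))"
  proof (intro mult_mono geom add_left_mono)
    have "real (prime_count (2 ^ h)) \<le> real (2 ^ h div 3 + 3)" by (intro of_nat_mono prime_count_le)
    also have "\<dots> \<le> 2 ^ h / 3 + 3" using of_nat_div_le_of_nat[of "2 ^ h" 3, where 'a = real] by simp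
    finally show "real (prime_count (2 ^ h)) \<le> 2 ^ h / 3 + 3" .
  qed auto
  also have "\<dots> = 1 / 6 + 2 / 2 ^ h" by (simp add: field_simps)
  finally show ?thesis using main assms by simp
qed

text \<open>
  With \<open>h\<close> about \<open>n / 2\<close> the lower bound tends to \<open>1 / 4 - 1 / 6 = 1 / 12\<close>.
\<close>

lemma sum_inverse_window_primes_ge_const:
  assumes "n \<ge> 100"
  shows "1 / 16 \<le> (\<Sum>p\<in>window_primes ((n + 1) div 2) n. 1 / real p)"
proof -
  let ?h = "(n + 1) div 2"
  have "(1024::real) = 2 ^ 10" by simp
  also have "\<dots> \<le> 2 ^ ?h" using assms by (intro power_increasing) auto
  finally have "2 / 2 ^ ?h \<le> (2::real) / 1024" by (intro divide_left_mono) auto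
  moreover have "real (n - ?h - 1) / (2 * real n) \<ge> 1 / 4 - 3 / 400"
  proof -
    have "n \<le> 2 * (n - ?h - 1) + 3" using assms by linarith
    then have "real n \<le> real (2 * (n - ?h - 1) + 3)" by (rule of_nat_mono)
    then have "real (n - ?h - 1) \<ge> (real n - 3) / 2" by simp
    then have "real (n - ?h - 1) / (2 * real n) \<ge> (real n - 3) / 2 / (2 * real n)"
      by (intro divide_right_mono) auto
    also have "(real n - 3) / 2 / (2 * real n) = 1 / 4 - 3 / (4 * real n)"
      using assms by (simp add: field_simps)
    finally have "1 / 4 - 3 / (4 * real n) \<le> real (n - ?h - 1) / (2 * real n)" .
    moreover have "3 / (4 * real n) \<le> 3 / 400" using assms by (intro divide_left_mono) auto
    ultimately show ?thesis by linarith
  qed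
  ultimately show ?thesis
    using sum_inverse_window_primes_ge[of ?h n] assms by linarith
qed

section \<open>Sums of periodic functions\<close>

definition periodic_mod :: "nat \<Rightarrow> (nat \<Rightarrow> real) \<Rightarrow> bool" where
  "periodic_mod q f \<longleftrightarrow> (\<forall>b. f (b mod q) = f b)"

text \<open>
  Independence modulo coprime periods, by the Chinese remainder theorem.
\<close>

lemma sum_mult_coprime_periods:
  assumes "coprime p q" "p > 0" "q > 0" "periodic_mod p f" "periodic_mod q F"
  shows "(\<Sum>b<p * q. f b * F b) = (\<Sum>r<p. f r) * (\<Sum>s<q. F s)"
proof -
  let ?\<phi> = "\<lambda>b. (b mod p, b mod q)"
  have inj: "inj_on ?\<phi> {..<p * q}"
  proof (rule inj_onI)
    fix b b' assume b: "b \<in> {..<p * q}" "b' \<in> {..<p * q}" "?\<phi> b = ?\<phi> b'"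
    then have "[b = b'] (mod p * q)"
      using assms(1) by (intro coprime_cong_mult_nat) (auto simp: cong_def)
    then show "b = b'" using b(1,2) by (intro cong_less_modulus_unique_nat) auto
  qed
  moreover have "?\<phi> ` {..<p * q} = {..<p} \<times> {..<q}"
  proof (rule card_subset_eq)
    show "?\<phi> ` {..<p * q} \<subseteq> {..<p} \<times> {..<q}" using assms(2,3) by auto
  qed (simp_all add: card_image[OF inj])
  ultimately have "bij_betw ?\<phi> {..<p * q} ({..<p} \<times> {..<q})" by (simp add: bij_betw_def)
  then have "(\<Sum>b<p * q. case ?\<phi> b of (r, s) \<Rightarrow> f r * F s)
      = (\<Sum>(r, s)\<in>{..<p} \<times> {..<q}. f r * F s)"
    by (rule sum.reindex_bij_betw)
  moreover have "f (b mod p) = f b" "F (b mod q) = F b" for b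
    using assms(4,5) by (simp_all add: periodic_mod_def)
  ultimately show ?thesis by (simp add: sum_product sum.cartesian_product)
qed

lemma periodic_mod_mult_period:
  assumes "periodic_mod p f" "p dvd q"
  shows "periodic_mod q f"
  unfolding periodic_mod_def
proof
  fix b
  have "f (b mod q) = f (b mod q mod p)" "f b = f (b mod p)"
    using assms(1) by (simp_all add: periodic_mod_def)
  then show "f (b mod q) = f b" using assms(2) by (simp add: mod_mod_cancel)
qed

lemma periodic_prod:
  assumes "finite E" "\<And>p. p \<in> E \<Longrightarrow> periodic_mod p (f p)"
  shows "periodic_mod (\<Prod>E) (\<lambda>b. \<Prod>p\<in>E. f p b)"
proof -
  have "periodic_mod (\<Prod>E) (f p)" if "p \<in> E" for p
    using periodic_mod_mult_period[OF assms(2)[OF that]] dvd_prodI[OF assms(1) that, of "\<lambda>p. p"]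
    by simp
  then show ?thesis by (simp add: periodic_mod_def)
qed

lemma sum_prod_prime_periods:
  assumes "finite E" "\<And>p. p \<in> E \<Longrightarrow> prime p" "\<And>p. p \<in> E \<Longrightarrow> periodic_mod p (f p)"
  shows "(\<Sum>b<\<Prod>E. \<Prod>p\<in>E. f p b) = (\<Prod>p\<in>E. \<Sum>r<p. f p r)"
  using assms
proof (induction E rule: finite_induct)
  case (insert p E)
  have p: "prime p" and E: "\<And>q. q \<in> E \<Longrightarrow> prime q" using insert.prems(1) by auto
  have "coprime p (\<Prod>E)"
  proof (rule prod_coprime_right)
    fix q assume "q \<in> E"
    then have "q \<noteq> p" using insert.hyps by auto
    then show "coprime p q" using primes_coprime[OF p E[OF \<open>q \<in> E\<close>]] by simp
  qed
  moreover have "p > 0" "\<Prod>E > 0" using p E by (auto intro!: prod_pos simp: prime_gt_0_nat)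
  moreover have "periodic_mod p (f p)" "periodic_mod (\<Prod>E) (\<lambda>b. \<Prod>q\<in>E. f q b)"
    using insert by (auto intro: periodic_prod)
  ultimately have "(\<Sum>b<p * \<Prod>E. f p b * (\<Prod>q\<in>E. f q b))
      = (\<Sum>r<p. f p r) * (\<Sum>b<\<Prod>E. \<Prod>q\<in>E. f q b)"
    by (rule sum_mult_coprime_periods)
  also have "(\<Sum>b<\<Prod>E. \<Prod>q\<in>E. f q b) = (\<Prod>q\<in>E. \<Sum>r<q. f q r)"
    using insert.prems by (intro insert.IH) auto
  finally show ?case using insert.hyps by simp
qed simp

lemma sum_whole_periods:
  assumes "periodic_mod q F"
  shows "(\<Sum>b<t * q. F b) = real t * (\<Sum>r<q. F r)"
proof -
  have block: "(\<Sum>b\<in>{i * q..<i * q + q}. F b) = (\<Sum>r<q. F r)" for i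
  proof -
    have "(\<Sum>b\<in>{i * q..<i * q + q}. F b) = (\<Sum>b\<in>{0 + i * q..<q + i * q}. F b)"
      by (simp add: add.commute)
    also have "\<dots> = (\<Sum>r\<in>{0..<q}. F (r + i * q))" by (rule sum.shift_bounds_nat_ivl)
    also have "\<dots> = (\<Sum>r<q. F r)"
    proof (rule sum.cong)
      fix r
      have per: "F (b mod q) = F b" for b using assms by (simp add: periodic_mod_def)
      have "F (r + i * q) = F ((r + i * q) mod q)" by (rule per[symmetric])
      also have "\<dots> = F (r mod q)" by simp
      also have "\<dots> = F r" by (rule per)
      finally show "F (r + i * q) = F r" .
    qed auto
    finally show ?thesis .
  qed
  have "(\<Sum>b<t * q. F b) = (\<Sum>i<t. \<Sum>b\<in>{i * q..<i * q + q}. F b)"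
    by (rule sum.nat_group[symmetric])
  also have "\<dots> = (\<Sum>i<t. \<Sum>r<q. F r)" by (simp only: block)
  finally show ?thesis by simp
qed

text \<open>
  Complete periods contribute nothing, so only an incomplete last period remains.
\<close>

lemma abs_sum_mean_zero_le:
  assumes "periodic_mod q F" "(\<Sum>r<q. F r) = 0" "q > 0" "\<And>b. \<bar>F b\<bar> \<le> K"
  shows "\<bar>\<Sum>b<X. F b\<bar> \<le> real q * K"
proof -
  have "K \<ge> 0" using assms(4)[of 0] by linarith
  let ?Y = "X div q * q"
  have Y: "?Y \<le> X" "X - ?Y \<le> q"
    using assms(3) by (simp_all add: minus_div_mult_eq_mod less_imp_le)
  have "(\<Sum>b<X. F b) = (\<Sum>b<?Y. F b) + (\<Sum>b\<in>{?Y..<X}. F b)"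
    using Y(1) by (simp add: sum.atLeastLessThan_concat flip: atLeast0LessThan)
  also have "(\<Sum>b<?Y. F b) = 0" by (simp add: sum_whole_periods[OF assms(1)] assms(2))
  finally have "\<bar>\<Sum>b<X. F b\<bar> \<le> (\<Sum>b\<in>{?Y..<X}. \<bar>F b\<bar>)" by simp
  also have "\<dots> \<le> real (card {?Y..<X}) * K" by (intro sum_bounded_above assms(4))
  also have "\<dots> \<le> real q * K"
    using Y(2) \<open>K \<ge> 0\<close> by (intro mult_right_mono of_nat_mono) simp_all
  finally show ?thesis .
qed

lemma sum_nonneg_periodic_le:
  assumes "periodic_mod q F" "q > 0" "q \<le> X" "\<And>b. F b \<ge> 0"
  shows "(\<Sum>b<X. F b) \<le> 2 * real X * ((\<Sum>r<q. F r) / real q)"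
proof -
  have S: "(\<Sum>r<q. F r) \<ge> 0" by (intro sum_nonneg assms(4))
  \<comment> \<open>By positivity the range may be rounded up to complete periods.\<close>
  have "X \<le> (X div q + 1) * q" using dividend_less_div_times[OF assms(2), of X] by simp
  then have "(\<Sum>b<X. F b) \<le> (\<Sum>b<(X div q + 1) * q. F b)" by (intro sum_mono2) (auto simp: assms(4))
  also have "\<dots> = real (X div q + 1) * (\<Sum>r<q. F r)" by (rule sum_whole_periods[OF assms(1)])
  also have "\<dots> \<le> (2 * real X / real q) * (\<Sum>r<q. F r)"
  proof (rule mult_right_mono[OF _ S])
    have "real (X div q) \<le> real X / real q" by (rule of_nat_div_le_of_nat)
    moreover have "1 \<le> real X / real q" using assms(2,3) by simp
    ultimately show "real (X div q + 1) \<le> 2 * real X / real q" by simp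
  qed
  finally show ?thesis by simp
qed


section \<open>Elementary symmetric sums\<close>

definition esum :: "nat \<Rightarrow> 'a set \<Rightarrow> ('a \<Rightarrow> real) \<Rightarrow> real" where
  "esum m P x = (\<Sum>D\<in>{D. D \<subseteq> P \<and> card D = m}. \<Prod>p\<in>D. x p)"

lemma esum_0: "finite P \<Longrightarrow> esum 0 P x = 1"
proof -
  assume "finite P"
  then have "{D. D \<subseteq> P \<and> card D = 0} = {{}}"
    by (auto simp: finite_subset card_eq_0_iff)
  then show ?thesis by (simp add: esum_def)
qed

text \<open>
  Both sides count pairs of a set of size \<open>Suc m\<close> and a distinguished element of it.
\<close>

lemma esum_Suc:
  assumes P: "finite P"
  shows "real (Suc m) * esum (Suc m) P x
    = (\<Sum>D\<in>{D. D \<subseteq> P \<and> card D = m}. (\<Prod>p\<in>D. x p) * (\<Sum>p\<in>P - D. x p))"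
proof -
  let ?F = "\<lambda>m. {D. D \<subseteq> P \<and> card D = m}"
  have fin: "finite (?F j)" for j using P by simp
  have finD: "finite D" if "D \<in> ?F j" for D j
    using that finite_subset[OF _ P] by simp
  have "real (Suc m) * esum (Suc m) P x = (\<Sum>D\<in>?F (Suc m). \<Sum>p\<in>D. \<Prod>q\<in>D. x q)"
    by (simp add: esum_def sum_distrib_left)
  also have "\<dots> = (\<Sum>(D, p)\<in>Sigma (?F (Suc m)) (\<lambda>D. D). \<Prod>q\<in>D. x q)"
    by (rule sum.Sigma[OF fin]) (intro ballI, rule finD)
  also have "\<dots> = (\<Sum>(D, p)\<in>Sigma (?F m) (\<lambda>D. P - D). (\<Prod>q\<in>D. x q) * x p)"
  proof (rule sum.reindex_bij_witness[where i = "\<lambda>(D, p). (insert p D, p)"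
        and j = "\<lambda>(D, p). (D - {p}, p)"])
    fix a assume "a \<in> Sigma (?F (Suc m)) (\<lambda>D. D)"
    then obtain D p where a: "a = (D, p)" "D \<subseteq> P" "card D = Suc m" "p \<in> D" by auto
    then have D: "finite D" using finite_subset[OF _ P] by simp
    show "(\<lambda>(D, p). (insert p D, p)) ((\<lambda>(D, p). (D - {p}, p)) a) = a" using a by auto
    show "(\<lambda>(D, p). (D - {p}, p)) a \<in> Sigma (?F m) (\<lambda>D. P - D)" using a D by auto
    show "(case (\<lambda>(D, p). (D - {p}, p)) a of (D, p) \<Rightarrow> (\<Prod>q\<in>D. x q) * x p)
        = (case a of (D, p) \<Rightarrow> \<Prod>q\<in>D. x q)"
      using a D by (simp add: prod.remove[of D p] mult.commute)
  next
    fix a assume "a \<in> Sigma (?F m) (\<lambda>D. P - D)"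
    then obtain D p where a: "a = (D, p)" "D \<subseteq> P" "card D = m" "p \<in> P" "p \<notin> D" by auto
    then have D: "finite D" using finite_subset[OF _ P] by simp
    show "(\<lambda>(D, p). (D - {p}, p)) ((\<lambda>(D, p). (insert p D, p)) a) = a" using a by auto
    show "(\<lambda>(D, p). (insert p D, p)) a \<in> Sigma (?F (Suc m)) (\<lambda>D. D)" using a D by auto
  qed
  also have "\<dots> = (\<Sum>D\<in>?F m. \<Sum>p\<in>P - D. (\<Prod>q\<in>D. x q) * x p)"
    by (rule sum.Sigma[OF fin, symmetric]) (simp add: P)
  finally show ?thesis by (simp add: sum_distrib_left)
qed

lemma fact_mult_esum_le:
  assumes P: "finite P" and x: "\<And>p. p \<in> P \<Longrightarrow> x p \<ge> 0"
  shows "fact m * esum m P x \<le> (\<Sum>p\<in>P. x p) ^ m"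
proof (induction m)
  case 0
  then show ?case by (simp add: esum_0 P)
next
  case (Suc m)
  have "real (Suc m) * esum (Suc m) P x
      \<le> (\<Sum>D\<in>{D. D \<subseteq> P \<and> card D = m}. (\<Prod>p\<in>D. x p) * (\<Sum>p\<in>P. x p))"
    unfolding esum_Suc[OF P] using P x
    by (intro sum_mono mult_left_mono sum_mono2 prod_nonneg) auto
  also have "\<dots> = (\<Sum>p\<in>P. x p) * esum m P x" by (simp add: esum_def sum_distrib_left mult.commute)
  finally have "fact m * (real (Suc m) * esum (Suc m) P x)
      \<le> fact m * ((\<Sum>p\<in>P. x p) * esum m P x)" by (intro mult_left_mono) auto
  also have "\<dots> = (\<Sum>p\<in>P. x p) * (fact m * esum m P x)" by simp
  also have "\<dots> \<le> (\<Sum>p\<in>P. x p) * (\<Sum>p\<in>P. x p) ^ m"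
    using Suc x by (intro mult_left_mono sum_nonneg) auto
  finally show ?case by (simp add: algebra_simps)
qed

text \<open>
  Each of the \<open>m\<close> successive choices of an element loses at most \<open>m * M\<close> from the full sum by avoiding
  the elements already chosen.
\<close>

lemma fact_mult_esum_ge:
  assumes P: "finite P" and x: "\<And>p. p \<in> P \<Longrightarrow> 0 \<le> x p \<and> x p \<le> M"
    and "0 \<le> M" "0 \<le> W" "W + real m * M \<le> (\<Sum>p\<in>P. x p)"
  shows "W ^ m \<le> fact m * esum m P x"
  using assms(5)
proof (induction m)
  case 0
  then show ?case by (simp add: esum_0 P)
next
  case (Suc m)
  have W: "W + real m * M \<le> (\<Sum>p\<in>P. x p)" using Suc.prems \<open>0 \<le> M\<close> by (simp add: distrib_right)
  have "W * esum m P x = (\<Sum>D\<in>{D. D \<subseteq> P \<and> card D = m}. (\<Prod>p\<in>D. x p) * W)"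
    by (simp add: esum_def sum_distrib_left mult.commute)
  also have "\<dots> \<le> real (Suc m) * esum (Suc m) P x"
    unfolding esum_Suc[OF P]
  proof (rule sum_mono, rule mult_left_mono)
    fix D assume D: "D \<in> {D. D \<subseteq> P \<and> card D = m}"
    have "(\<Sum>p\<in>D. x p) \<le> real (card D) * M" using D x by (intro sum_bounded_above) auto
    moreover have "(\<Sum>p\<in>P - D. x p) = (\<Sum>p\<in>P. x p) - (\<Sum>p\<in>D. x p)"
      using D P by (intro sum_diff) auto
    ultimately show "W \<le> (\<Sum>p\<in>P - D. x p)" using D W by simp
    show "0 \<le> (\<Prod>p\<in>D. x p)" using D x by (intro prod_nonneg) auto
  qed
  finally have *: "fact m * (W * esum m P x) \<le> fact m * (real (Suc m) * esum (Suc m) P x)"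
    by (intro mult_left_mono) auto
  have "W * W ^ m \<le> W * (fact m * esum m P x)" using Suc.IH[OF W] \<open>0 \<le> W\<close> by (rule mult_left_mono)
  also have "\<dots> = fact m * (W * esum m P x)" by simp
  also note *
  finally show ?case by (simp add: algebra_simps)
qed


section \<open>A second moment sieve\<close>

text \<open>
  Let \<open>T b\<close> be the \<open>m\<close>-th elementary symmetric polynomial in the \<open>g p b\<close>. On \<open>B\<close> its square is the
  constant \<open>(esum m P w)\<^sup>2\<close>, so the left side is at most the sum of \<open>(T b)\<^sup>2\<close> over all \<open>b < X\<close>.
  Expanding the square gives a sum over pairs \<open>(D, D')\<close>. The diagonal pairs give products of
  variances. For \<open>D \<noteq> D'\<close> some prime occurs in only one of the two sets, the mean over a full period
  vanishes, and the error from the incomplete period is at most \<open>N ^ (4 * m)\<close>; there are at most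
  \<open>N ^ (2 * m)\<close> pairs.
\<close>

lemma second_moment_sieve:
  fixes g :: "nat \<Rightarrow> nat \<Rightarrow> real"
  assumes P: "finite P" "\<And>p. p \<in> P \<Longrightarrow> prime p \<and> p < N"
    and g: "\<And>p. p \<in> P \<Longrightarrow> periodic_mod p (g p)" "\<And>p. p \<in> P \<Longrightarrow> (\<Sum>r<p. g p r) = 0"
      "\<And>p b. p \<in> P \<Longrightarrow> \<bar>g p b\<bar> \<le> real N"
    and B: "B \<subseteq> {..<X}" "\<And>p b. p \<in> P \<Longrightarrow> b \<in> B \<Longrightarrow> g p b = - w p"
    and X: "N ^ m \<le> X" and N: "N \<ge> 1"
  shows "real (card B) * (esum m P w)\<^sup>2
    \<le> 2 * real X * esum m P (\<lambda>p. (\<Sum>r<p. (g p r)\<^sup>2) / real p) + real N ^ (6 * m)"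
proof -
  let ?F = "{D. D \<subseteq> P \<and> card D = m}"
  define G where "G D b = (\<Prod>p\<in>D. g p b)" for D b
  have finF: "finite ?F" using P(1) by simp
  have D: "finite D" "D \<subseteq> P" "card D = m" if "D \<in> ?F" for D
    using that finite_subset[OF _ P(1)] by simp_all
  have N': "real N \<ge> 1" using N by simp
  have absG: "\<bar>G D b\<bar> \<le> real N ^ m" if "D \<in> ?F" for D b
  proof -
    have "\<bar>G D b\<bar> = (\<Prod>p\<in>D. \<bar>g p b\<bar>)" by (simp add: G_def abs_prod)
    also have "\<dots> \<le> (\<Prod>p\<in>D. real N)" using D[OF that] g(3) by (intro prod_mono) auto
    finally show ?thesis using D[OF that] by simp
  qed
  have diag: "(\<Sum>b<X. G D b * G D b) \<le> 2 * real X * (\<Prod>p\<in>D. (\<Sum>r<p. (g p r)\<^sup>2) / real p)"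
    if DF: "D \<in> ?F" for D
  proof -
    note D' = D[OF DF]
    have prime: "prime p" if "p \<in> D" for p using that D' P(2) by auto
    have per: "periodic_mod p (\<lambda>b. (g p b)\<^sup>2)" if "p \<in> D" for p
      using g(1)[of p] that D' by (auto simp: periodic_mod_def)
    have sq: "G D b * G D b = (\<Prod>p\<in>D. (g p b)\<^sup>2)" for b
      by (simp add: G_def power2_eq_square prod.distrib)
    have q: "\<Prod>D > 0" using prime by (auto intro!: prod_pos simp: prime_gt_0_nat)
    have "\<Prod>D \<le> (\<Prod>p\<in>D. N)" using D' P(2) by (intro prod_mono) (auto simp: less_imp_le)
    then have "\<Prod>D \<le> X" using D' X by simp
    then have "(\<Sum>b<X. \<Prod>p\<in>D. (g p b)\<^sup>2)
        \<le> 2 * real X * ((\<Sum>r<\<Prod>D. \<Prod>p\<in>D. (g p r)\<^sup>2) / real (\<Prod>D))"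
      using q D' per by (intro sum_nonneg_periodic_le periodic_prod) (auto intro!: prod_nonneg)
    also have "(\<Sum>r<\<Prod>D. \<Prod>p\<in>D. (g p r)\<^sup>2) = (\<Prod>p\<in>D. \<Sum>r<p. (g p r)\<^sup>2)"
      using D' prime per by (intro sum_prod_prime_periods)
    finally show ?thesis by (simp add: sq prod_dividef)
  qed
  have off: "(\<Sum>b<X. G D b * G D' b) \<le> real N ^ (4 * m)"
    if DF: "D \<in> ?F" "D' \<in> ?F" and ne: "D \<noteq> D'" for D D'
  proof -
    note D1 = D[OF DF(1)] and D2 = D[OF DF(2)]
    define E where "E = D \<union> D'"
    \<comment> \<open>Primes in both sets contribute a square, the others a single factor of mean zero.\<close>
    define f where "f p b = (if p \<in> D then g p b else 1) * (if p \<in> D' then g p b else 1)" for p b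
    have E: "finite E" "E \<subseteq> P" using D1 D2 by (auto simp: E_def)
    have prime: "prime p" if "p \<in> E" for p using that E P(2) by auto
    have eq: "G D b * G D' b = (\<Prod>p\<in>E. f p b)" for b
    proof -
      have "G D b = (\<Prod>p\<in>E. if p \<in> D then g p b else 1)"
        "G D' b = (\<Prod>p\<in>E. if p \<in> D' then g p b else 1)"
        unfolding G_def using E(1) by (auto simp: E_def intro!: prod.mono_neutral_cong_left)
      then show ?thesis by (simp add: f_def prod.distrib)
    qed
    have per: "periodic_mod p (f p)" if "p \<in> E" for p
      using g(1)[of p] that E by (auto simp: periodic_mod_def f_def)
    have perG: "periodic_mod (\<Prod>E) (\<lambda>b. G D b * G D' b)"
      unfolding eq using E(1) per by (rule periodic_prod)
    have "\<exists>p\<in>E. (\<Sum>r<p. f p r) = 0"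
    proof -
      have "\<not> D \<subseteq> D'" using card_subset_eq[OF D2(1), of D] D1 D2 ne by auto
      then obtain p where p: "p \<in> D" "p \<notin> D'" by auto
      then have "(\<Sum>r<p. f p r) = (\<Sum>r<p. g p r)" by (simp add: f_def)
      also have "\<dots> = 0" using p D1 g(2) by auto
      finally show ?thesis using p by (auto simp: E_def)
    qed
    then have "(\<Prod>p\<in>E. \<Sum>r<p. f p r) = 0" using E(1) by (simp add: prod_zero_iff)
    then have zero: "(\<Sum>b<\<Prod>E. G D b * G D' b) = 0"
      unfolding eq using sum_prod_prime_periods[OF E(1) prime per] by simp
    have "\<Prod>E > 0" using prime by (auto intro!: prod_pos simp: prime_gt_0_nat)
    have "\<bar>G D b * G D' b\<bar> \<le> real N ^ m * real N ^ m" for b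
      unfolding abs_mult by (intro mult_mono absG DF) auto
    from abs_sum_mean_zero_le[OF perG zero \<open>\<Prod>E > 0\<close> this]
    have "(\<Sum>b<X. G D b * G D' b) \<le> real (\<Prod>E) * (real N ^ m * real N ^ m)" by (meson abs_le_D1)
    also have "\<dots> \<le> real N ^ (2 * m) * (real N ^ m * real N ^ m)"
    proof (rule mult_right_mono)
      have "\<Prod>E \<le> (\<Prod>p\<in>E. N)" using E P(2) by (intro prod_mono) (auto simp: less_imp_le)
      also have "\<dots> \<le> N ^ (2 * m)"
        using card_Un_le[of D D'] D1 D2 N by (auto simp: E_def intro!: power_increasing)
      finally show "real (\<Prod>E) \<le> real N ^ (2 * m)" by (metis of_nat_le_iff of_nat_power)
    qed auto
    also have "\<dots> = real N ^ (4 * m)" by (simp flip: power_add)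
    finally show ?thesis .
  qed
  have cardF: "real (card ?F) \<le> real N ^ m"
  proof -
    have "card P \<le> N"
      using card_mono[of "{..<N}" P] P(2) by auto
    have "card ?F = card P choose m" using P(1) by (rule n_subsets)
    also have "\<dots> \<le> card P ^ m"
      by (cases "m \<le> card P") (auto simp: binomial_le_pow binomial_eq_0)
    also have "\<dots> \<le> N ^ m" using \<open>card P \<le> N\<close> by (rule power_mono) simp
    finally show ?thesis by (metis of_nat_le_iff of_nat_power)
  qed
  have onB: "(\<Sum>D\<in>?F. G D b)\<^sup>2 = (esum m P w)\<^sup>2" if "b \<in> B" for b
  proof -
    have "G D b = (- 1) ^ m * (\<Prod>p\<in>D. w p)" if DF: "D \<in> ?F" for D
    proof -
      have "G D b = (\<Prod>p\<in>D. - 1 * w p)"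
        unfolding G_def using D[OF DF] B(2) \<open>b \<in> B\<close> by (intro prod.cong) auto
      then show ?thesis using D[OF DF] by (simp only: prod.distrib prod_constant)
    qed
    then have "(\<Sum>D\<in>?F. G D b) = (- 1) ^ m * esum m P w"
      by (simp add: esum_def sum_distrib_left)
    then show ?thesis by (simp add: power_mult_distrib flip: power_mult)
  qed
  have "real (card B) * (esum m P w)\<^sup>2 = (\<Sum>b\<in>B. (\<Sum>D\<in>?F. G D b)\<^sup>2)"
    by (simp add: onB)
  also have "\<dots> \<le> (\<Sum>b<X. (\<Sum>D\<in>?F. G D b)\<^sup>2)" using B(1) by (intro sum_mono2) auto
  also have "\<dots> = (\<Sum>b<X. \<Sum>D\<in>?F. \<Sum>D'\<in>?F. G D b * G D' b)"
    by (simp add: power2_eq_square sum_product)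
  also have "\<dots> = (\<Sum>D\<in>?F. \<Sum>D'\<in>?F. \<Sum>b<X. G D b * G D' b)"
    by (subst sum.swap) (intro sum.cong refl sum.swap)
  also have "\<dots> \<le> (\<Sum>D\<in>?F. 2 * real X * (\<Prod>p\<in>D. (\<Sum>r<p. (g p r)\<^sup>2) / real p)
      + real N ^ m * real N ^ (4 * m))"
  proof (rule sum_mono)
    fix D assume DF: "D \<in> ?F"
    have "(\<Sum>D'\<in>?F. \<Sum>b<X. G D b * G D' b)
        = (\<Sum>b<X. G D b * G D b) + (\<Sum>D'\<in>?F - {D}. \<Sum>b<X. G D b * G D' b)"
      using finF DF by (rule sum.remove)
    also have "(\<Sum>D'\<in>?F - {D}. \<Sum>b<X. G D b * G D' b) \<le> (\<Sum>D'\<in>?F - {D}. real N ^ (4 * m))"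
      using DF by (intro sum_mono off) auto
    also have "\<dots> \<le> (\<Sum>D'\<in>?F. real N ^ (4 * m))" using finF by (intro sum_mono2) auto
    also have "\<dots> \<le> real N ^ m * real N ^ (4 * m)" using cardF by (simp add: mult_right_mono)
    finally show "(\<Sum>D'\<in>?F. \<Sum>b<X. G D b * G D' b)
        \<le> 2 * real X * (\<Prod>p\<in>D. (\<Sum>r<p. (g p r)\<^sup>2) / real p) + real N ^ m * real N ^ (4 * m)"
      using diag[OF DF] by linarith
  qed
  also have "\<dots> = 2 * real X * esum m P (\<lambda>p. (\<Sum>r<p. (g p r)\<^sup>2) / real p)
      + real (card ?F) * (real N ^ m * real N ^ (4 * m))"
    by (simp add: sum.distrib esum_def sum_distrib_left)
  also have "real (card ?F) * (real N ^ m * real N ^ (4 * m))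
      \<le> real N ^ m * (real N ^ m * real N ^ (4 * m))"
    by (intro mult_right_mono cardF) auto
  also have "\<dots> = real N ^ (6 * m)" by (simp flip: power_add)
  finally show ?thesis by simp
qed

section \<open>Simultaneous primality\<close>

definition hits :: "nat set \<Rightarrow> nat \<Rightarrow> nat \<Rightarrow> nat \<Rightarrow> nat" where
  "hits S N p b = card {a \<in> S. p dvd a + N * b}"

lemma of_nat_card_filter:
  "finite S \<Longrightarrow> real (card {a \<in> S. Q a}) = (\<Sum>a\<in>S. of_bool (Q a))"
  by (simp add: of_bool_def sum.If_cases Int_def)

lemma hits_le: "finite S \<Longrightarrow> hits S N p b \<le> card S"
  unfolding hits_def by (rule card_mono) auto

lemma sum_residues_solving_congruence:
  assumes "coprime N p" "p > (0::nat)"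
  shows "(\<Sum>r<p. of_bool (p dvd a + N * r) :: real) = 1"
proof -
  obtain x where x: "p dvd a + N * x" using ex_dvd_linear[OF assms] by blast
  have "p dvd a + N * r \<longleftrightarrow> r = x mod p" if "r < p" for r
  proof -
    have "p dvd a + N * r \<longleftrightarrow> [a + N * r = a + N * x] (mod p)"
      using x by (auto simp: cong_def mod_eq_0_iff_dvd)
    also have "\<dots> \<longleftrightarrow> [r = x] (mod p)"
      using assms(1) by (simp add: cong_add_lcancel_nat cong_mult_lcancel_nat)
    also have "\<dots> \<longleftrightarrow> r = x mod p" using that by (simp add: cong_def)
    finally show ?thesis .
  qed
  then have "(\<Sum>r<p. of_bool (p dvd a + N * r) :: real) = (\<Sum>r<p. of_bool (r = x mod p))"
    by (intro sum.cong) auto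
  also have "\<dots> = 1" using assms(2) by (simp add: of_bool_def)
  finally show ?thesis .
qed

lemma sum_hits:
  assumes "finite S" "coprime N p" "p > 0"
  shows "(\<Sum>r<p. real (hits S N p r)) = real (card S)"
proof -
  have "(\<Sum>r<p. real (hits S N p r)) = (\<Sum>a\<in>S. \<Sum>r<p. of_bool (p dvd a + N * r))"
    unfolding hits_def of_nat_card_filter[OF assms(1)] by (rule sum.swap)
  then show ?thesis by (simp only: sum_residues_solving_congruence[OF assms(2,3)]) simp
qed

text \<open>
  For fixed \<open>a\<close> and \<open>a'\<close>, a common solution \<open>r\<close> forces \<open>[a = a'] (mod p)\<close>, and there is never more
  than one.
\<close>

lemma sum_hits_squared_le:
  assumes "finite S" "coprime N p" "p > 0"
  shows "(\<Sum>r<p. (real (hits S N p r))\<^sup>2) \<le> (\<Sum>a\<in>S. \<Sum>a'\<in>S. of_bool ([a = a'] (mod p)))"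
proof -
  let ?I = "\<lambda>a r. of_bool (p dvd a + N * r) :: real"
  have "(\<Sum>r<p. (real (hits S N p r))\<^sup>2) = (\<Sum>r<p. \<Sum>a\<in>S. \<Sum>a'\<in>S. ?I a r * ?I a' r)"
    unfolding hits_def of_nat_card_filter[OF assms(1)] power2_eq_square sum_product ..
  also have "\<dots> = (\<Sum>a\<in>S. \<Sum>r<p. \<Sum>a'\<in>S. ?I a r * ?I a' r)" by (rule sum.swap)
  also have "\<dots> = (\<Sum>a\<in>S. \<Sum>a'\<in>S. \<Sum>r<p. ?I a r * ?I a' r)" by (intro sum.cong refl sum.swap)
  also have "\<dots> \<le> (\<Sum>a\<in>S. \<Sum>a'\<in>S. of_bool ([a = a'] (mod p)))"
  proof (intro sum_mono)
    fix a a' assume "a \<in> S" "a' \<in> S"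
    show "(\<Sum>r<p. ?I a r * ?I a' r) \<le> of_bool ([a = a'] (mod p))"
    proof (cases "[a = a'] (mod p)")
      case True
      have "(\<Sum>r<p. ?I a r * ?I a' r) \<le> (\<Sum>r<p. ?I a r)" by (intro sum_mono) auto
      then show ?thesis using True by (simp only: sum_residues_solving_congruence[OF assms(2,3)]) simp
    next
      case False
      have "?I a r * ?I a' r = 0" for r
      proof (rule ccontr)
        assume "?I a r * ?I a' r \<noteq> 0"
        then have "p dvd a + N * r" "p dvd a' + N * r" by (auto split: if_splits)
        then have "[a + N * r = a' + N * r] (mod p)" by (simp add: cong_def mod_eq_0_iff_dvd)
        then show False using False by (simp add: cong_add_rcancel_nat)
      qed
      then show ?thesis by simp
    qed
  qed
  finally show ?thesis .
qed

text \<open>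
  Two distinct primes above \<open>H\<close> have a product larger than \<open>H\<^sup>2\<close>, hence larger than \<open>\<bar>a - a'\<bar>\<close>. This
  is why the sieving primes start at about \<open>2 ^ (n / 2)\<close>.
\<close>

lemma card_common_prime_divisors_le_1:
  assumes "finite P" "\<And>p. p \<in> P \<Longrightarrow> prime p \<and> H < p" "a < N" "a' < N" "N \<le> H ^ 2" "a \<noteq> (a'::nat)"
  shows "card {p \<in> P. [a = a'] (mod p)} \<le> 1"
proof -
  have "p = q" if p: "p \<in> P" "[a = a'] (mod p)" and q: "q \<in> P" "[a = a'] (mod q)" for p q
  proof (rule ccontr)
    assume "p \<noteq> q"
    then have "coprime p q" using primes_coprime[of p q] assms(2) p(1) q(1) by simp
    then have "[a = a'] (mod p * q)" using p(2) q(2) coprime_cong_mult_nat by simp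
    moreover have "H * H \<le> p * q" using assms(2)[OF p(1)] assms(2)[OF q(1)] by (intro mult_le_mono) auto
    then have "a < p * q" "a' < p * q" using assms(3-5) by (auto simp: power2_eq_square)
    ultimately have "a = a'" by (intro cong_less_modulus_unique_nat[of a a' "p * q"])
    then show False using assms(6) by simp
  qed
  then show ?thesis using assms(1) by (auto simp: card_le_Suc0_iff_eq)
qed

text \<open>
  The diagonal pairs contribute the main term. Every other pair is counted for at most one prime, with
  a weight of at most \<open>1 / H\<close>.
\<close>

lemma sum_congruent_pairs_le:
  assumes P: "finite P" "\<And>p. p \<in> P \<Longrightarrow> prime p \<and> H < p" and H: "H > 0" "N \<le> H ^ 2"
    and S: "S \<subseteq> {..<N}"
  shows "(\<Sum>p\<in>P. (\<Sum>a\<in>S. \<Sum>a'\<in>S. of_bool ([a = a'] (mod p))) / real p)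
    \<le> real (card S) * (\<Sum>p\<in>P. 1 / real p) + (real (card S))\<^sup>2 / real H"
proof -
  have fS: "finite S" using S by (rule finite_subset) simp
  let ?o = "\<lambda>p. \<Sum>a\<in>S. \<Sum>a'\<in>S - {a}. of_bool ([a = a'] (mod p)) :: real"
  have split: "(\<Sum>a\<in>S. \<Sum>a'\<in>S. of_bool ([a = a'] (mod p)) :: real) = real (card S) + ?o p" for p
  proof -
    have "(\<Sum>a'\<in>S. of_bool ([a = a'] (mod p)) :: real) = 1 + (\<Sum>a'\<in>S - {a}. of_bool ([a = a'] (mod p)))"
      if "a \<in> S" for a
      by (subst sum.remove[OF fS that]) simp
    then show ?thesis by (simp add: sum.distrib)
  qed
  have o_nonneg: "?o p \<ge> 0" for p by (intro sum_nonneg) auto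
  have term_le: "(\<Sum>a\<in>S. \<Sum>a'\<in>S. of_bool ([a = a'] (mod p))) / real p
      \<le> real (card S) * (1 / real p) + ?o p / real H" if "p \<in> P" for p
  proof -
    have "?o p / real p \<le> ?o p / real H"
      using P(2)[OF that] H(1) o_nonneg[of p] by (intro divide_left_mono) auto
    then show ?thesis by (simp add: split add_divide_distrib)
  qed
  have "(\<Sum>p\<in>P. ?o p) \<le> (real (card S))\<^sup>2"
  proof -
    have "(\<Sum>p\<in>P. ?o p) = (\<Sum>a\<in>S. \<Sum>p\<in>P. \<Sum>a'\<in>S - {a}. of_bool ([a = a'] (mod p)))"
      by (rule sum.swap)
    also have "\<dots> = (\<Sum>a\<in>S. \<Sum>a'\<in>S - {a}. \<Sum>p\<in>P. of_bool ([a = a'] (mod p)))"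
      by (intro sum.cong refl sum.swap)
    also have "\<dots> \<le> (\<Sum>a\<in>S. \<Sum>a'\<in>S - {a}. 1)"
    proof (intro sum_mono)
      fix a a' assume a: "a \<in> S" "a' \<in> S - {a}"
      then have "card {p \<in> P. [a = a'] (mod p)} \<le> 1"
        using S by (intro card_common_prime_divisors_le_1[OF P _ _ H(2)]) auto
      then show "(\<Sum>p\<in>P. of_bool ([a = a'] (mod p))) \<le> (1::real)"
        unfolding of_nat_card_filter[OF P(1), symmetric] by simp
    qed
    also have "\<dots> \<le> (\<Sum>a\<in>S. \<Sum>a'\<in>S. 1)" using fS by (intro sum_mono sum_mono2) auto
    also have "\<dots> = (real (card S))\<^sup>2" by (simp add: power2_eq_square)
    finally show ?thesis .
  qed
  then have "(\<Sum>p\<in>P. ?o p) / real H \<le> (real (card S))\<^sup>2 / real H" by (intro divide_right_mono) auto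
  moreover have "(\<Sum>p\<in>P. (\<Sum>a\<in>S. \<Sum>a'\<in>S. of_bool ([a = a'] (mod p))) / real p)
      \<le> (\<Sum>p\<in>P. real (card S) * (1 / real p) + ?o p / real H)"
    by (intro sum_mono term_le)
  ultimately show ?thesis by (simp add: sum.distrib sum_distrib_left sum_divide_distrib)
qed

text \<open>
  The sieve is applied to \<open>g p b = hits S N p b - k / p\<close>. For the exceptional \<open>b\<close> there are no hits,
  since a prime \<open>a + N * b \<ge> N > p\<close> is not divisible by \<open>p\<close>. The sum of the variances is at most
  \<open>k * \<sigma> + k\<^sup>2 / H\<close>. The two conditions on \<open>2 * m\<close> keep the \<open>m\<close>-th symmetric sum of the \<open>k / p\<close>
  comparable to \<open>(k * \<sigma>) ^ m / fact m\<close> and at least 1, so that the error term \<open>N ^ (6 * m) = X\<close> of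
  the sieve does not dominate.
\<close>

lemma card_simultaneous_primes_le:
  fixes n h m N H X :: nat and S :: "nat set" and \<sigma> k :: real
  defines "N \<equiv> 2 ^ n" and "H \<equiv> 2 ^ h" and "\<sigma> \<equiv> \<Sum>p\<in>window_primes h n. 1 / real p"
    and "k \<equiv> real (card S)" and "X \<equiv> (2 ^ n) ^ (6 * m)"
  assumes h: "h \<ge> 1" "N \<le> H ^ 2" and S: "S \<subseteq> {..<N}" and m: "m \<ge> 1" "2 * m \<le> k * \<sigma>" "2 * m \<le> H * \<sigma>"
  shows "real (card {b \<in> {1..<X}. \<forall>a\<in>S. prime (a + N * b)})
    \<le> 3 * real X * (4 * m * (k * \<sigma> + k\<^sup>2 / H) / (k * \<sigma>)\<^sup>2) ^ m"
proof -
  let ?P = "window_primes h n"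
  let ?B = "{b \<in> {1..<X}. \<forall>a\<in>S. prime (a + N * b)}"
  define g where "g p b = real (hits S N p b) - k / real p" for p b
  define w where "w p = k / real p" for p :: nat
  define v where "v p = (\<Sum>r<p. (g p r)\<^sup>2) / real p" for p
  have fS: "finite S" using S by (rule finite_subset) simp
  have k0: "k \<ge> 0" by (simp add: k_def)
  have P: "prime p" "H < p" "p < N" "p > 0" "coprime N p" if "p \<in> ?P" for p
  proof -
    show p: "prime p" "H < p" "p < N" using that by (auto simp: window_primes_def H_def N_def)
    then show "p > 0" by (simp add: prime_gt_0_nat)
    have "2 ^ 1 \<le> H" unfolding H_def by (rule power_increasing) (use h in auto)
    then have "odd p" using p by (intro prime_odd_nat) auto
    then show "coprime N p" unfolding N_def by simp
  qed
  have N1: "N \<ge> 1" by (simp add: N_def)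
  have kN: "k \<le> real N" using card_mono[OF _ S] by (simp add: k_def)
  have sum_g: "(\<Sum>r<p. real (hits S N p r)) = k" if "p \<in> ?P" for p
    unfolding k_def using sum_hits[OF fS P(5,4)[OF that]] .
  have v_le: "v p \<le> (\<Sum>a\<in>S. \<Sum>a'\<in>S. of_bool ([a = a'] (mod p))) / real p" if "p \<in> ?P" for p
  proof -
    note p = P[OF that]
    have "(\<Sum>r<p. (g p r)\<^sup>2)
        = (\<Sum>r<p. (real (hits S N p r))\<^sup>2 - 2 * (k / real p) * real (hits S N p r) + (k / real p)\<^sup>2)"
      by (intro sum.cong refl) (simp add: g_def power2_diff)
    also have "\<dots> = (\<Sum>r<p. (real (hits S N p r))\<^sup>2) - 2 * (k / real p) * k + real p * (k / real p)\<^sup>2"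
      unfolding sum.distrib sum_subtractf sum_distrib_left[symmetric] sum_g[OF that] by simp
    also have "real p * (k / real p)\<^sup>2 = (k / real p) * k" using p(4) by (simp add: power2_eq_square)
    also have "(\<Sum>r<p. (real (hits S N p r))\<^sup>2) - 2 * (k / real p) * k + k / real p * k
        \<le> (\<Sum>r<p. (real (hits S N p r))\<^sup>2)"
      using k0 by (simp add: mult_nonneg_nonneg)
    also have "\<dots> \<le> (\<Sum>a\<in>S. \<Sum>a'\<in>S. of_bool ([a = a'] (mod p)))"
      by (rule sum_hits_squared_le[OF fS p(5,4)])
    finally show ?thesis unfolding v_def by (intro divide_right_mono) auto
  qed
  have v_nonneg: "v p \<ge> 0" for p unfolding v_def by (intro divide_nonneg_nonneg sum_nonneg) auto
  define W where "W = k * \<sigma>"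
  define U where "U = k * \<sigma> + k\<^sup>2 / H"
  have WU: "W \<le> U" "W > 0" using m k0 by (auto simp: W_def U_def)
  have "(\<Sum>p\<in>?P. v p) \<le> U"
  proof -
    have "(\<Sum>p\<in>?P. v p) \<le> (\<Sum>p\<in>?P. (\<Sum>a\<in>S. \<Sum>a'\<in>S. of_bool ([a = a'] (mod p))) / real p)"
      by (intro sum_mono v_le)
    also have "\<dots> \<le> real (card S) * (\<Sum>p\<in>?P. 1 / real p) + (real (card S))\<^sup>2 / real H"
      using P h S by (intro sum_congruent_pairs_le[of _ _ N]) (auto simp: H_def)
    finally show ?thesis by (simp add: U_def k_def \<sigma>_def)
  qed
  have E_le: "fact m * esum m ?P v \<le> U ^ m"
  proof -
    have "fact m * esum m ?P v \<le> (\<Sum>p\<in>?P. v p) ^ m"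
      using v_nonneg by (intro fact_mult_esum_le) simp_all
    also have "\<dots> \<le> U ^ m"
      using \<open>(\<Sum>p\<in>?P. v p) \<le> U\<close> v_nonneg by (intro power_mono sum_nonneg)
    finally show ?thesis .
  qed
  have e_ge: "(W / 2) ^ m \<le> fact m * esum m ?P w"
  proof (rule fact_mult_esum_ge[where M = "k / H"])
    fix p assume "p \<in> ?P"
    then have "real H \<le> real p" "real H > 0" using P(2)[of p] by (auto simp: H_def)
    then show "0 \<le> w p \<and> w p \<le> k / H"
      using k0 by (auto simp: w_def intro: divide_left_mono)
  next
    have "real m / H \<le> \<sigma> / 2" using m(3) by (simp add: H_def field_simps)
    then have "k * (real m / H) \<le> k * (\<sigma> / 2)" using k0 by (rule mult_left_mono)
    moreover have "(\<Sum>p\<in>?P. w p) = W" by (simp add: w_def W_def \<sigma>_def sum_distrib_left)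
    ultimately show "W / 2 + real m * (k / H) \<le> (\<Sum>p\<in>?P. w p)" by (simp add: W_def mult.commute)
  qed (use WU k0 in \<open>simp_all\<close>)
  have fact_le: "fact m \<le> real m ^ m" using fact_le_power[of m, where 'a = real] by simp
  have fact_le_W: "fact m \<le> (W / 2) ^ m"
  proof -
    have "real m ^ m \<le> (W / 2) ^ m" using m(2) by (intro power_mono) (auto simp: W_def)
    then show ?thesis using fact_le by linarith
  qed
  have "fact m \<le> U ^ m"
  proof -
    have "(W / 2) ^ m \<le> U ^ m" using WU by (intro power_mono) auto
    then show ?thesis using fact_le_W by linarith
  qed
  have X: "real X = real N ^ (6 * m)" "N ^ m \<le> X"
    using N1 by (auto simp: X_def N_def intro!: power_increasing)
  have "real (card ?B) * (esum m ?P w)\<^sup>2 \<le> 2 * real X * esum m ?P v + real N ^ (6 * m)"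
    unfolding v_def
  proof (rule second_moment_sieve)
    fix p assume p: "p \<in> ?P"
    show "prime p \<and> p < N" using P[OF p] by simp
    show "periodic_mod p (g p)"
      unfolding periodic_mod_def
    proof
      fix b
      have "p dvd a + N * (b mod p) \<longleftrightarrow> p dvd a + N * b" for a
      proof -
        have "[a + N * (b mod p) = a + N * b] (mod p)"
          by (intro cong_add cong_mult cong_refl) (simp add: cong_def)
        then show ?thesis by (simp only: dvd_eq_mod_eq_0 cong_def)
      qed
      then show "g p (b mod p) = g p b" by (simp only: g_def hits_def)
    qed
    show "(\<Sum>r<p. g p r) = 0"
      using P(4)[OF p] by (simp add: g_def sum_subtractf sum_g[OF p])
    show "\<bar>g p b\<bar> \<le> real N" for b
    proof -
      have "real (hits S N p b) \<le> k" unfolding k_def by (intro of_nat_mono hits_le fS)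
      moreover have "k / real p \<le> k" "0 \<le> k / real p"
        using k0 P(4)[OF p] by (auto simp: divide_le_eq mult_le_cancel_left1)
      moreover have "0 \<le> real (hits S N p b)" by simp
      ultimately show ?thesis using kN unfolding g_def abs_le_iff by linarith
    qed
    show "g p b = - w p" if "b \<in> ?B" for b
    proof -
      have "\<not> p dvd a + N * b" if "a \<in> S" for a
      proof
        assume "p dvd a + N * b"
        moreover have "prime (a + N * b)" using \<open>b \<in> ?B\<close> that by simp
        ultimately have "p = a + N * b" using P(1)[OF p] by (simp add: primes_dvd_imp_eq)
        moreover have "N * 1 \<le> N * b" using \<open>b \<in> ?B\<close> by (intro mult_left_mono) auto
        ultimately show False using P(3)[OF p] by simp
      qed
      then have "hits S N p b = 0" using fS by (auto simp: hits_def)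
      then show ?thesis by (simp add: g_def w_def)
    qed
  qed (use X N1 in auto)
  also have "\<dots> = real X * (2 * esum m ?P v + 1)" by (simp add: X(1) algebra_simps)
  finally have *: "real (card ?B) * (esum m ?P w)\<^sup>2 \<le> real X * (2 * esum m ?P v + 1)" .
  have "real (card ?B) * ((W / 2) ^ m)\<^sup>2 \<le> real (card ?B) * (fact m * esum m ?P w)\<^sup>2"
    using e_ge WU by (intro mult_left_mono power_mono) auto
  also have "\<dots> = (fact m)\<^sup>2 * (real (card ?B) * (esum m ?P w)\<^sup>2)" by (simp add: power_mult_distrib)
  also have "\<dots> \<le> (fact m)\<^sup>2 * (real X * (2 * esum m ?P v + 1))" by (intro mult_left_mono *) simp
  also have "\<dots> = real X * fact m * (2 * (fact m * esum m ?P v) + fact m)"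
    by (simp add: power2_eq_square algebra_simps)
  also have "\<dots> \<le> real X * fact m * (3 * U ^ m)"
    using E_le \<open>fact m \<le> U ^ m\<close> by (intro mult_left_mono) auto
  also have "\<dots> \<le> real X * real m ^ m * (3 * U ^ m)"
    using WU by (intro mult_right_mono mult_left_mono fact_le) auto
  finally have "real (card ?B) * ((W / 2) ^ m)\<^sup>2 \<le> real X * real m ^ m * (3 * U ^ m)" .
  then have "real (card ?B) \<le> real X * real m ^ m * (3 * U ^ m) / ((W / 2) ^ m)\<^sup>2"
    using WU by (subst pos_le_divide_eq) auto
  also have "\<dots> = 3 * real X * ((real m * U) ^ m / ((W / 2)\<^sup>2) ^ m)"
    by (simp add: power_mult_distrib flip: power_mult) (simp add: mult.commute)
  also have "(real m * U) ^ m / ((W / 2)\<^sup>2) ^ m = (4 * m * U / W\<^sup>2) ^ m"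
    by (simp add: power_divide[symmetric] power2_eq_square mult_ac)
  finally show ?thesis by (simp add: U_def W_def)
qed

section \<open>Prime-rich columns\<close>

lemma card_le_card_image_mult:
  assumes "finite G" "\<And>b. b \<in> G \<Longrightarrow> real (card {b' \<in> G. f b' = f b}) \<le> R"
  shows "real (card G) \<le> real (card (f ` G)) * R"
proof -
  have "G = (\<Union>c\<in>f ` G. {b \<in> G. f b = c})" by auto
  then have "card G \<le> (\<Sum>c\<in>f ` G. card {b \<in> G. f b = c})"
    using card_UN_le[of "f ` G" "\<lambda>c. {b \<in> G. f b = c}"] assms(1) by simp
  then have "real (card G) \<le> (\<Sum>c\<in>f ` G. real (card {b \<in> G. f b = c}))"
    unfolding of_nat_sum[symmetric] by (rule of_nat_mono)
  also have "\<dots> \<le> (\<Sum>c\<in>f ` G. R)" using assms(2) by (intro sum_mono) auto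
  finally show ?thesis by simp
qed

lemma prime_count_le_sum_columns:
  fixes n :: nat
  assumes "X > 0"
  shows "prime_count (2 ^ n * X) \<le> 2 ^ n + 1 + (\<Sum>b\<in>{1..<X}. card (column prime n b))"
proof -
  let ?N = "2 ^ n :: nat"
  have "{p. prime p \<and> p \<le> ?N * X}
    \<subseteq> ({..<?N} \<union> {?N * X}) \<union> (\<Union>b\<in>{1..<X}. (\<lambda>a. a + ?N * b) ` column prime n b)"
  proof
    fix p assume p: "p \<in> {p. prime p \<and> p \<le> ?N * X}"
    show "p \<in> ({..<?N} \<union> {?N * X}) \<union> (\<Union>b\<in>{1..<X}. (\<lambda>a. a + ?N * b) ` column prime n b)"
    proof (cases "p < ?N \<or> p = ?N * X")
      case False
      then have lt: "p < X * ?N" "?N \<le> p" using p by (auto simp: mult.commute)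
      have "p div ?N < X" using lt(1) by (simp add: less_mult_imp_div_less)
      moreover have "1 \<le> p div ?N" using lt(2) by (simp add: less_eq_div_iff_mult_less_eq)
      moreover have eq: "p mod ?N + ?N * (p div ?N) = p" by simp
      moreover have "p mod ?N \<in> column prime n (p div ?N)" using p eq by (simp add: column_def)
      ultimately show ?thesis by (intro UnI2 UN_I[of "p div ?N"] image_eqI[of _ _ "p mod ?N"]) auto
    qed auto
  qed
  then have "prime_count (?N * X)
      \<le> card (({..<?N} \<union> {?N * X}) \<union> (\<Union>b\<in>{1..<X}. (\<lambda>a. a + ?N * b) ` column prime n b))"
    unfolding prime_count_def by (rule card_mono[rotated]) simp
  also have "\<dots> \<le> card ({..<?N} \<union> {?N * X})
      + card (\<Union>b\<in>{1..<X}. (\<lambda>a. a + ?N * b) ` column prime n b)" by (rule card_Un_le)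
  also have "card ({..<?N} \<union> {?N * X}) \<le> ?N + 1"
    using card_Un_le[of "{..<?N}" "{?N * X}"] by simp
  also have "card (\<Union>b\<in>{1..<X}. (\<lambda>a. a + ?N * b) ` column prime n b)
      \<le> (\<Sum>b\<in>{1..<X}. card ((\<lambda>a. a + ?N * b) ` column prime n b))" by (rule card_UN_le) simp
  also have "\<dots> \<le> (\<Sum>b\<in>{1..<X}. card (column prime n b))" by (intro sum_mono card_image_le) simp
  finally show ?thesis by simp
qed

text \<open>
  There are at least about \<open>2 ^ n * X / J\<close> primes below \<open>2 ^ n * X = 2 ^ J\<close>. Columns with fewer than
  \<open>2 ^ n div (4 * J)\<close> elements account for at most a quarter of these, and a column contains at most
  \<open>2 ^ n\<close> of them.
\<close>

lemma many_prime_rich_columns: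
  fixes n m :: nat
  defines "J \<equiv> n * (6 * m + 1)" and "X \<equiv> (2 ^ n) ^ (6 * m)"
  defines "G \<equiv> {b \<in> {1..<X}. 2 ^ n div (4 * J) \<le> card (column prime n b)}"
  assumes nm: "n * m \<ge> 2"
  shows "X \<le> 2 * J * card G"
proof -
  define N :: nat where "N = 2 ^ n"
  define k where "k = N div (4 * J)"
  define c where "c b = card (column prime n b)" for b
  have "n \<noteq> 0" "m \<noteq> 0" using nm by (metis mult_0 mult_0_right not_numeral_le_zero)+
  then have pos: "n \<ge> 1" "m \<ge> 1" "N \<ge> 1" by (simp_all add: N_def)
  then have J1: "J \<ge> 1" by (simp add: J_def)
  have "X > 0" by (simp add: X_def)
  have XN: "N * X = 2 ^ J" by (simp add: N_def X_def J_def add.commute flip: power_mult power_add)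
  have "12 * J \<le> X"
  proof -
    have "n \<le> n * m" using pos(2) by simp
    moreover have "J = 6 * (n * m) + n" by (simp add: J_def algebra_simps)
    ultimately have "12 * J \<le> 84 * (n * m)" by linarith
    also have "\<dots> \<le> 2 ^ 10 * 2 ^ (n * m)" by (intro mult_le_mono less_imp_le less_exp) simp
    also have "\<dots> \<le> 2 ^ (5 * (n * m)) * 2 ^ (n * m)"
      using nm by (intro mult_right_mono power_increasing) (linarith | simp)+
    also have "\<dots> = X" by (simp add: X_def mult_ac flip: power_mult power_add)
    finally show ?thesis .
  qed
  have c_le: "c b \<le> N" for b
    using card_mono[of "{..<N}" "column prime n b"] by (auto simp: c_def column_def N_def)
  have finG: "finite G" by (simp add: G_def)
  have "(\<Sum>b\<in>{1..<X}. c b) \<le> (\<Sum>b\<in>{1..<X}. (if b \<in> G then N else 0) + k)"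
  proof (rule sum_mono)
    fix b assume "b \<in> {1..<X}"
    then show "c b \<le> (if b \<in> G then N else 0) + k"
      using c_le[of b] by (auto simp: G_def k_def N_def c_def)
  qed
  also have "\<dots> = card ({1..<X} \<inter> G) * N + (X - 1) * k"
    by (simp add: sum.distrib sum.If_cases Int_def)
  also have "{1..<X} \<inter> G = G" by (auto simp: G_def)
  also have "card G * N + (X - 1) * k \<le> card G * N + X * k" by simp
  finally have sum_c: "(\<Sum>b\<in>{1..<X}. c b) \<le> card G * N + X * k" .
  have "N * X \<le> 1 + J * prime_count (N * X)"
    using prime_count_power_two_ge[of J] unfolding XN by linarith
  also have "\<dots> \<le> 1 + J * (N + 1 + (card G * N + X * k))"
    using prime_count_le_sum_columns[OF \<open>X > 0\<close>, of n] sum_c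
    by (intro add_left_mono mult_left_mono) (auto simp: N_def c_def)
  finally have "4 * (N * X) \<le> 4 + 4 * (J * N) + 4 * J + 4 * (J * card G * N) + X * (4 * J * k)"
    by (simp add: algebra_simps)
  also have "X * (4 * J * k) \<le> X * N" unfolding k_def by (intro mult_left_mono) simp_all
  also have "4 + 4 * (J * N) + 4 * J \<le> 12 * J * N"
  proof -
    have "1 * 1 \<le> J * N" "J * 1 \<le> J * N" using J1 pos by (auto intro!: mult_le_mono)
    then show ?thesis by linarith
  qed
  also have "12 * J * N \<le> X * N" using \<open>12 * J \<le> X\<close> by (rule mult_right_mono) simp
  finally have "X * N \<le> (2 * J * card G) * N" by (simp add: algebra_simps)
  then show ?thesis using pos(3) by simp
qed

text \<open>
  Taking logarithms: \<open>n \<ge> 5120\<^sup>2\<close> gives \<open>5120 / n \<le> 1 / sqrt n\<close>, so that \<open>f\<close> is at least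
  \<open>(m / 2) * ln n\<close> up to an error of order \<open>n\<close>. As \<open>m \<ge> 4 * n\<close>, half of the main term absorbs
  the error.
\<close>

lemma exponent_ge_of_counting_bound:
  assumes n: "n \<ge> (26214400::nat)" and nH: "4 * n\<^sup>2 \<le> 2 ^ h" and h: "h \<le> n" "n \<le> 2 * h"
    and m: "m = 2 ^ h div n"
    and f: "1 \<le> 42 * 2 ^ h * 2 ^ f * (5120 / real n) ^ m"
  shows "1 / 8 * (2 powr (real n / 2) * ln (real n) / real n) \<le> real f"
proof -
  define H :: nat where "H = 2 ^ h"
  have n0: "real n > 0" using n by simp
  have "4 * n * n \<le> H" using nH by (simp add: H_def power2_eq_square)
  then have "4 * n \<le> m" unfolding m H_def[symmetric] using n by (simp add: less_eq_div_iff_mult_less_eq)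
  then have m4: "4 * real n \<le> real m" by linarith
  have ln2: "ln (real n) \<ge> 2"
  proof -
    have "exp 2 = exp 1 * exp (1::real)" by (simp flip: exp_add)
    also have "\<dots> \<le> 3 * 3" using exp_le by (intro mult_mono) auto
    also have "\<dots> \<le> real n" using n by simp
    finally show ?thesis using n0 by (simp add: ln_ge_iff)
  qed
  have ln_ratio: "ln (5120 / real n) \<le> - (ln (real n) / 2)"
  proof -
    have "5120 * 5120 \<le> real n" using n by simp
    then have "ln (5120 * 5120) \<le> ln (real n)" by (subst ln_le_cancel_iff) (use n0 in auto)
    then have "2 * ln 5120 \<le> ln (real n)" by (simp only: ln_mult_pos zero_less_numeral)
    then show ?thesis using n0 by (simp add: ln_div)
  qed
  have ln_two: "ln 2 \<le> (1::real)" "ln 2 > (0::real)" using ln_le_minus_one[of 2] by auto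
  have "0 \<le> ln (42 * 2 ^ h * 2 ^ f * (5120 / real n) ^ m)" using f by simp
  also have "\<dots> = ln 42 + real h * ln 2 + real f * ln 2 + real m * ln (5120 / real n)"
    using n0 by (simp add: ln_mult_pos ln_realpow)
  also have "ln 42 \<le> (41::real)" using ln_le_minus_one[of 42] by simp
  also have "real h * ln 2 \<le> real n * 1" using h ln_two by (intro mult_mono) auto
  also have "real f * ln 2 \<le> real f * 1" using ln_two by (intro mult_left_mono) auto
  also have "real m * ln (5120 / real n) \<le> real m * (- (ln (real n) / 2))"
    using ln_ratio by (intro mult_left_mono) auto
  finally have "real m * ln (real n) / 2 \<le> real f + real n + 41" by simp
  moreover have "4 * real n * 2 \<le> real m * ln (real n)" using m4 ln2 n0 by (intro mult_mono) auto
  ultimately have "real m * ln (real n) / 4 \<le> real f" using n by simp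
  moreover have "2 powr (real n / 2) / (2 * real n) \<le> real m"
  proof -
    have "H < (m + 1) * n" unfolding m H_def[symmetric] using dividend_less_div_times[of n H] n by simp
    then have "real H \<le> (real m + 1) * real n" by (metis less_imp_le of_nat_1 of_nat_add of_nat_le_iff of_nat_mult)
    also have "\<dots> \<le> (2 * real m) * real n" using m4 n by (intro mult_right_mono) auto
    finally have "real H \<le> real m * (2 * real n)" by simp
    moreover have "2 powr (real n / 2) \<le> 2 powr real h" using h(2) by (intro powr_mono) auto
    ultimately show ?thesis using n0 by (simp add: H_def powr_realpow divide_le_eq)
  qed
  then have "2 powr (real n / 2) / (2 * real n) * ln (real n) \<le> real m * ln (real n)"
    using ln2 by (intro mult_right_mono) auto
  ultimately show ?thesis by simp
qed

section \<open>The state complexity of the primes and of the squarefree numbers\<close>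

text \<open>
  A crude comparison of polynomial and exponential growth that makes \<open>2 ^ h\<close> exceed \<open>4 * n\<^sup>2\<close>.
\<close>

lemma cube_le_power_two: "h ^ 3 \<le> 27 * 2 ^ (h::nat)"
proof -
  define q where "q = h div 3"
  have "h \<le> 3 * (q + 1)" by (simp add: q_def)
  also have "\<dots> \<le> 3 * 2 ^ q" using Suc_leI[OF less_exp[of q]] by simp
  finally have "h ^ 3 \<le> (3 * 2 ^ q) ^ 3" by (rule power_mono) simp
  also have "\<dots> = 27 * 2 ^ (3 * q)" by (simp add: power_mult_distrib mult.commute flip: power_mult)
  also have "\<dots> \<le> 27 * 2 ^ h" by (intro mult_left_mono power_increasing) (auto simp: q_def)
  finally show ?thesis .
qed

text \<open>
  With \<open>m\<close> about \<open>2 ^ (n / 2) / n\<close>, both \<open>J\<close> and \<open>k\<close> are of order \<open>H\<close>, where \<open>H = 2 ^ h\<close> is about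
  \<open>2 ^ (n / 2)\<close>, and \<open>\<rho>\<close>, which is of order \<open>m / k\<close>, is at most \<open>5120 / n\<close>. At least
  \<open>X / (2 * J)\<close> values \<open>b\<close> have rich columns and each such column belongs to at most \<open>3 * X * \<rho> ^ m\<close> of
  them; the quotient bounds the number of columns, hence \<open>2 ^ f\<close>, from below. The threshold for \<open>n\<close>
  is \<open>5120\<^sup>2\<close>.
\<close>

theorem alt_state_complexity_prime_ge_large:
  assumes n: "n \<ge> (26214400::nat)"
  shows "1 / 8 * (2 powr (real n / 2) * ln (real n) / real n)
    \<le> real (alt_state_complexity L_prime n)"
proof -
  define h where "h = (n + 1) div 2"
  define N H m J X where "N = (2::nat) ^ n" and "H = (2::nat) ^ h" and "m = H div n"
    and "J = n * (6 * m + 1)" and "X = ((2::nat) ^ n) ^ (6 * m)"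
  define k where "k = N div (4 * J)"
  define \<sigma> where "\<sigma> = (\<Sum>p\<in>window_primes h n. 1 / real p)"
  define G where "G = {b \<in> {1..<X}. k \<le> card (column prime n b)}"
  let ?f = "alt_state_complexity L_prime n"
  have h: "h \<le> n" "n \<le> 2 * h" "2 * h \<le> n + 1" "h \<ge> 1" using n by (auto simp: h_def)
  have n0: "real n > 0" using n by simp
  have \<sigma>: "\<sigma> \<ge> 1 / 16" unfolding \<sigma>_def h_def using n by (intro sum_inverse_window_primes_ge_const) simp
  have nH: "4 * n\<^sup>2 \<le> H"
  proof -
    have "864 * n\<^sup>2 \<le> n * n\<^sup>2" using n by (intro mult_right_mono) simp_all
    also have "\<dots> = n ^ 3" by (simp add: power2_eq_square power3_eq_cube)
    also have "\<dots> \<le> (2 * h) ^ 3" using h(2) by (rule power_mono) simp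
    also have "\<dots> = 8 * h ^ 3" by (simp add: power_mult_distrib)
    also have "\<dots> \<le> 216 * H" using cube_le_power_two[of h] by (simp add: H_def)
    finally show ?thesis by simp
  qed
  have "n * 1 \<le> n * n" using n by (intro mult_left_mono) simp_all
  then have nH': "4 * n \<le> H" "4 * (n * n) \<le> H" using nH unfolding power2_eq_square by linarith+
  have NH: "N \<le> H\<^sup>2" "H\<^sup>2 \<le> 2 * N"
  proof -
    have "N \<le> 2 ^ (2 * h)" unfolding N_def using h by (intro power_increasing) simp_all
    then show "N \<le> H\<^sup>2" by (simp add: H_def mult.commute flip: power_mult)
    have "(2::nat) ^ (2 * h) \<le> 2 ^ (n + 1)" using h by (intro power_increasing) simp_all
    then show "H\<^sup>2 \<le> 2 * N" by (simp add: H_def N_def mult.commute flip: power_mult)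
  qed
  have "4 * n \<le> m" unfolding m_def using n nH'(2)
    by (simp add: less_eq_div_iff_mult_less_eq mult.assoc)
  then have m1: "m \<ge> 1" using n by simp
  have nm: "n * m \<le> H" unfolding m_def by simp
  have "2 \<le> n * m"
  proof -
    have "2 * 1 \<le> n * m" using n m1 by (intro mult_le_mono) simp_all
    then show ?thesis by simp
  qed
  have J: "J \<le> 7 * H"
  proof -
    have "n * 1 \<le> n * m" using m1 by (rule mult_left_mono) simp
    moreover have "J = 6 * (n * m) + n" by (simp add: J_def algebra_simps)
    ultimately show ?thesis using nm by linarith
  qed
  have J1: "J \<ge> 1" using n by (simp add: J_def)
  have H0: "real H > 0" by (simp add: H_def)
  have Hbig: "real H \<ge> 4 * 26214400" using nH'(1) n by linarith
  have k_ge: "real H / 64 \<le> real k"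
  proof -
    have "N < (k + 1) * (4 * J)"
      unfolding k_def using dividend_less_div_times[of "4 * J" N] J1 by simp
    also have "\<dots> \<le> (k + 1) * (28 * H)" using J by (intro mult_left_mono) simp_all
    finally have "H\<^sup>2 \<le> 2 * ((k + 1) * (28 * H))" using NH(2) by linarith
    then have "H * H \<le> H * (56 * (k + 1))" by (simp add: power2_eq_square algebra_simps)
    then have "H \<le> 56 * (k + 1)" using H0 by simp
    then have "real H \<le> real (56 * (k + 1))" by (rule of_nat_mono)
    then show ?thesis using Hbig by simp
  qed
  have k_pos: "real k > 0" using k_ge H0 by linarith
  have m_le: "real m \<le> real H / real n"
    unfolding m_def by (rule of_nat_div_le_of_nat)
  have m_le': "2 * real m \<le> real H / 1024"
  proof -
    have "real H / real n \<le> real H / 2048" using n H0 by (intro divide_left_mono) simp_all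
    then show ?thesis using m_le by linarith
  qed
  have k\<sigma>: "real H / 1024 \<le> real k * \<sigma>"
  proof -
    have "real H / 64 * (1 / 16) \<le> real k * \<sigma>" using k_ge \<sigma> H0 by (intro mult_mono) simp_all
    then show ?thesis by simp
  qed
  have H\<sigma>: "real H / 16 \<le> real H * \<sigma>"
    using mult_left_mono[OF \<sigma>, of "real H"] H0 by simp
  define \<rho> where "\<rho> = real (4 * m) * (real k * \<sigma> + (real k)\<^sup>2 / H) / (real k * \<sigma>)\<^sup>2"
  have \<rho>0: "\<rho> \<ge> 0" unfolding \<rho>_def using \<sigma> by (intro divide_nonneg_nonneg mult_nonneg_nonneg add_nonneg_nonneg) simp_all
  have \<rho>: "\<rho> \<le> 5120 / real n"
  proof -
    have "\<rho> = 4 * real m * (1 / (real k * \<sigma>) + 1 / (real H * \<sigma> * \<sigma>))"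
      unfolding \<rho>_def using k_pos \<sigma> H0 by (simp add: field_simps power2_eq_square)
    also have "\<dots> \<le> 4 * (real H / real n) * (1 / (real H / 1024) + 1 / (real H / 256))"
    proof (intro mult_mono add_mono divide_left_mono)
      have "real H / 16 * (1 / 16) \<le> real H * \<sigma> * \<sigma>"
        using H\<sigma> \<sigma> H0 by (intro mult_mono) simp_all
      then show "real H / 256 \<le> real H * \<sigma> * \<sigma>" by simp
    qed (use m_le k\<sigma> H0 k_pos \<sigma> n0 in \<open>auto intro!: add_nonneg_nonneg\<close>)
    also have "\<dots> = 5120 / real n" using H0 n0 by (simp add: field_simps)
    finally show ?thesis .
  qed
  have finG: "finite G" by (simp add: G_def)
  have class_le: "real (card {b' \<in> G. column prime n b' = column prime n b}) \<le> 3 * real X * \<rho> ^ m"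
    if "b \<in> G" for b
  proof -
    have "k \<le> card (column prime n b)" using that by (simp add: G_def)
    then obtain S where S: "S \<subseteq> column prime n b" "card S = k"
      by (rule obtain_subset_with_card_n)
    have "{b' \<in> G. column prime n b' = column prime n b}
        \<subseteq> {b \<in> {1..<X}. \<forall>a\<in>S. prime (a + 2 ^ n * b)}"
    proof
      fix b' assume b': "b' \<in> {b' \<in> G. column prime n b' = column prime n b}"
      have "prime (a + 2 ^ n * b')" if "a \<in> S" for a
      proof -
        have "a \<in> column prime n b'" using that S(1) b' by auto
        then show ?thesis by (simp add: column_def)
      qed
      then show "b' \<in> {b \<in> {1..<X}. \<forall>a\<in>S. prime (a + 2 ^ n * b)}" using b' by (simp add: G_def)
    qed
    then have "card {b' \<in> G. column prime n b' = column prime n b}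
        \<le> card {b \<in> {1..<X}. \<forall>a\<in>S. prime (a + 2 ^ n * b)}"
      by (rule card_mono[rotated]) simp
    then have "real (card {b' \<in> G. column prime n b' = column prime n b})
        \<le> real (card {b \<in> {1..<X}. \<forall>a\<in>S. prime (a + 2 ^ n * b)})" by (rule of_nat_mono)
    also have "\<dots> \<le> 3 * real ((2 ^ n) ^ (6 * m)) * (4 * m * (real (card S) * (\<Sum>p\<in>window_primes h n. 1 / real p)
        + (real (card S))\<^sup>2 / (2 ^ h :: nat)) / (real (card S) * (\<Sum>p\<in>window_primes h n. 1 / real p))\<^sup>2) ^ m"
      unfolding X_def
    proof (rule card_simultaneous_primes_le)
      show "S \<subseteq> {..<2 ^ n}" using S(1) by (auto simp: column_def)
      show "real (2 * m) \<le> real (card S) * (\<Sum>p\<in>window_primes h n. 1 / real p)"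
        using m_le' k\<sigma> unfolding \<sigma>_def[symmetric] S(2) by simp
      show "real (2 * m) \<le> real (2 ^ h) * (\<Sum>p\<in>window_primes h n. 1 / real p)"
        using m_le' H\<sigma> H0 unfolding \<sigma>_def[symmetric] H_def[symmetric] of_nat_mult of_nat_numeral
        by linarith
    qed (use h m1 NH(1) in \<open>simp_all add: N_def H_def\<close>)
    finally show ?thesis unfolding S(2) \<sigma>_def[symmetric] H_def[symmetric] X_def[symmetric] \<rho>_def .
  qed
  have "real X \<le> real (2 * J * card G)"
    using many_prime_rich_columns[OF \<open>2 \<le> n * m\<close>]
    unfolding X_def[symmetric] J_def[symmetric]
    unfolding N_def[symmetric] k_def[symmetric] G_def[symmetric]
    by (rule of_nat_mono)
  also have "\<dots> = 2 * real J * real (card G)" by simp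
  also have "\<dots> \<le> 2 * (7 * real H) * (real (card (column prime n ` G)) * (3 * real X * \<rho> ^ m))"
    using J card_le_card_image_mult[OF finG class_le] by (intro mult_mono) simp_all
  also have "\<dots> \<le> 2 * (7 * real H) * (2 ^ ?f * (3 * real X * \<rho> ^ m))"
  proof (intro mult_left_mono mult_right_mono)
    have "card (column prime n ` G) \<le> 2 ^ ?f"
      by (rule card_columns_le(2)[OF L_prime_def]) (simp add: G_def)
    then have "real (card (column prime n ` G)) \<le> real (2 ^ ?f)" by (rule of_nat_mono)
    then show "real (card (column prime n ` G)) \<le> 2 ^ ?f" by simp
  qed (use \<rho>0 in simp_all)
  also have "\<dots> \<le> 2 * (7 * real H) * (2 ^ ?f * (3 * real X * (5120 / real n) ^ m))"
    using \<rho> \<rho>0 by (intro mult_left_mono power_mono) simp_all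
  also have "\<dots> = real X * (42 * 2 ^ h * 2 ^ ?f * (5120 / real n) ^ m)" by (simp add: H_def)
  finally have "real X * 1 \<le> real X * (42 * 2 ^ h * 2 ^ ?f * (5120 / real n) ^ m)" by simp
  moreover have "real X > 0" by (simp add: X_def)
  ultimately have "1 \<le> 42 * 2 ^ h * 2 ^ ?f * (5120 / real n) ^ m" by (simp only: mult_le_cancel_left_pos)
  then show ?thesis
    using n nH h m_def unfolding H_def by (intro exponent_ge_of_counting_bound) simp_all
qed

text \<open>
  Small \<open>n\<close> cost only a smaller constant, because at least the start state is always reachable.
\<close>

theorem alt_state_complexity_prime_ge:
  "\<exists>c>0. \<forall>n\<ge>1. c * (2 powr (real n / 2) * ln (real n) / real n)
    \<le> real (alt_state_complexity L_prime n)"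
proof -
  obtain n0 where large: "\<forall>n\<ge>n0. 1 / 8 * (2 powr (real n / 2) * ln (real n) / real n)
      \<le> real (alt_state_complexity L_prime n)"
    using alt_state_complexity_prime_ge_large by blast
  define c where "c = min (1 / 8) (1 / 2 powr real n0)"
  have "c * (2 powr (real n / 2) * ln (real n) / real n) \<le> real (alt_state_complexity L_prime n)"
    if n: "n \<ge> 1" for n
  proof -
    let ?g = "2 powr (real n / 2) * ln (real n) / real n"
    have g0: "?g \<ge> 0" using n by simp
    show ?thesis
    proof (cases "n \<ge> n0")
      case True
      have "c * ?g \<le> 1 / 8 * ?g" using g0 by (intro mult_right_mono) (simp_all add: c_def)
      then show ?thesis using large True by (meson order_trans)
    next
      case False
      have "ln (real n) \<le> real n" using ln_le_minus_one[of "real n"] n by simp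
      then have "?g \<le> 2 powr (real n / 2)" using n by (simp add: divide_le_eq)
      also have "\<dots> \<le> 2 powr real n0" using False by (intro powr_mono) simp_all
      finally have "c * ?g \<le> 1 / 2 powr real n0 * 2 powr real n0"
        using g0 by (intro mult_mono) (simp_all add: c_def)
      also have "\<dots> = 1" by simp
      also have "\<dots> \<le> real (alt_state_complexity L_prime n)"
        using alt_state_complexity_pos[of L_prime n] by simp
      finally show ?thesis .
    qed
  qed
  moreover have "c > 0" by (simp add: c_def)
  ultimately show ?thesis by blast
qed

theorem sqf_state_complexity_bounds:
  assumes n: "n \<ge> 1"
  shows "2 powr (real n - 2) \<le> real (alt_state_complexity L_sqf n)"
    and "real (det_state_complexity L_sqf n) \<le> 2 powr (real n + 2)"
proof -
  have "2 ^ n \<le> 4 * alt_state_complexity L_sqf n"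
    using card_odd_sqf_below[OF n] alt_state_complexity_sqf_ge[OF n] by linarith
  then have "real (2 ^ n) \<le> real (4 * alt_state_complexity L_sqf n)" by (rule of_nat_mono)
  then show "2 powr (real n - 2) \<le> real (alt_state_complexity L_sqf n)"
    by (simp add: powr_diff powr_realpow)
  have "real (det_state_complexity L_sqf n) \<le> real (2 ^ (n + 1))"
    by (intro of_nat_mono det_state_complexity_binary_le)
  also have "\<dots> = 2 powr real (n + 1)" by (simp only: powr_realpow of_nat_power of_nat_numeral zero_less_numeral)
  also have "\<dots> \<le> 2 powr (real n + 2)" by (intro powr_mono) simp_all
  finally show "real (det_state_complexity L_sqf n) \<le> 2 powr (real n + 2)" .
qed

theorem theorem1p1:
  "(\<exists>c::real. c > 0 \<and>
      (\<forall>n::nat. n \<ge> 1 \<longrightarrow>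
         real (alt_state_complexity L_prime n) \<ge> c * (2 powr (real n / 2) * ln (real n) / real n)))
   \<and> (\<exists>C::real. \<forall>n::nat. n \<ge> 1 \<longrightarrow>
         2 powr (real n - C) \<le> real (det_state_complexity L_sqf n)
       \<and> real (det_state_complexity L_sqf n) \<le> 2 powr (real n + C)
       \<and> 2 powr (real n - C) \<le> real (alt_state_complexity L_sqf n)
       \<and> real (alt_state_complexity L_sqf n) \<le> 2 powr (real n + C))"
proof (intro conjI)
  show "\<exists>c::real. c > 0 \<and>
      (\<forall>n::nat. n \<ge> 1 \<longrightarrow>
         real (alt_state_complexity L_prime n) \<ge> c * (2 powr (real n / 2) * ln (real n) / real n))"
    using alt_state_complexity_prime_ge by simp
  have "real (alt_state_complexity L_sqf n) \<le> real (det_state_complexity L_sqf n)" for n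
    by (intro of_nat_mono alt_le_det_state_complexity)
  then show "\<exists>C::real. \<forall>n::nat. n \<ge> 1 \<longrightarrow>
         2 powr (real n - C) \<le> real (det_state_complexity L_sqf n)
       \<and> real (det_state_complexity L_sqf n) \<le> 2 powr (real n + C)
       \<and> 2 powr (real n - C) \<le> real (alt_state_complexity L_sqf n)
       \<and> real (alt_state_complexity L_sqf n) \<le> 2 powr (real n + C)"
    using sqf_state_complexity_bounds by (intro exI[of _ 2]) (meson order_trans)
qed

end
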